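(* Let $R=[r]\times[s]$, $x\in\mathbb R^R$ and $k\in\mathbb Z_{\ge0}$. (a) If $1\le u\le v\le r$, then $H_{u,1}^{v,s}(x;k)=H_{u,1}^{v,s}(\mathrm{RSK}^{-1}\circ\mathrm{Evac}^P\circ\mathrm{RSK}(x);k)$. (b) If $1\le u\le v\le s$, then $H_{1,u}^{r,v}(x;k)=H_{1,s+1-v}^{r,s+1-u}(\mathrm{RSK}^{-1}\circ\mathrm{Evac}^P\circ\mathrm{RSK}(x);k)$.
   Context: **Toggles, RSK.** $R=[r]\times[s]$ carries the product order, $[n]=\{1,\dots,n\}$; write $p\lessdot q$ for cover relations. For $p\in R$ the toggle $t_p:\mathbb R^R\to\mathbb R^R$ replaces $x_p$ by $\min_{q\gtrdot p}x_q+\max_{q\lessdot p}x_q-x_p$ and fixes all other labels (empty $\max=0$, empty $\min=1$). The transfer map $\phi:\mathbb R^R\to\mathbb R^R$ is the bijection $\phi(x)_p=x_p-\max_{q\lessdot p}x_q$ (empty $\max=0$). For $I\subseteq R$ with $n$ elements and any linear extension $L:I\to[n]$ (order-preserving bijection), $\rho_I=t_{L^{-1}(1)}\circ\cdots\circ t_{L^{-1}(n)}$ (independent of $L$); $\rho_{i,j}=\rho_{[i]\times[j]}$. With $m=\min(r,s)$, $\mathrm{RSK}=\rho^{-1}_{r-m+1,s-m+1}\circ\cdots\circ\rho^{-1}_{r-2,s-2}\circ\rho^{-1}_{r-1,s-1}\circ\phi^{-1}$ (equal to $\phi^{-1}$ if $m=1$). **Promotion and evacuation.** Let $F_k=\{(a,b)\in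 R:a-b=k\}$ and $F_k^{ij}=F_k\cap([i]\times[j])$. Set $\mathrm{Pro}^P_{i,j}=\rho_{F^{ij}_{i-j+1}}\circ\cdots\circ\rho_{F^{ij}_{i-2}}\circ\rho_{F^{ij}_{i-1}}:\mathbb R^R\to\mathbb R^R$ and $\mathrm{Evac}^P=\mathrm{Pro}^P_{r,2}\circ\cdots\circ\mathrm{Pro}^P_{r,s-1}\circ\mathrm{Pro}^P_{r,s}$ (empty compositions are the identity). **Path statistics.** For $u_1\le u_2$, $v_1\le v_2$ and $0\le k\le\min(u_2-u_1+1,v_2-v_1+1)$, $H_{u_1,v_1}^{u_2,v_2}(x;k)$ is the maximum, over all systems of $k$ pairwise vertex-disjoint lattice paths (steps $(1,0)$ and $(0,1)$) from $(u_1,v_1),\dots,(u_1,v_1+k-1)$ to $(u_2,v_2-k+1),\dots,(u_2,v_2)$, of the sum of the labels $x_{ij}$ of all vertices on the paths; for larger $k$ it is constant, equal to its value at $k=\min(u_2-u_1+1,v_2-v_1+1)$. *)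

theory Defs
  imports Complex_Main "HOL-Library.Product_Order"
begin

text \<open>
  A labelling in \<open>\<real>\<^sup>R\<close>, where \<open>R = [r] \<times> [s]\<close>, is represented by a total function on
  \<open>nat \<times> nat\<close>. The maps on labellings below (toggles being used only at positions in \<open>R\<close>)
  read and change only the labels in \<open>R\<close> and fix the labels outside \<open>R\<close>, so they are
  permutations of the whole function type exactly when they are permutations of \<open>\<real>\<^sup>R\<close>, and
  \<open>inv\<close> is the inverse in both senses.
  The order on \<open>nat \<times> nat\<close> is the componentwise one of \<open>Product_Order\<close>.
\<close>

type_synonym labelling = "nat \<times> nat \<Rightarrow> real"

definition rect :: "nat \<Rightarrow> nat \<Rightarrow> (nat \<times> nat) set" where
  "rect i j = {1..i} \<times> {1..j}"

definition covered_by :: "'a::order set \<Rightarrow> 'a \<Rightarrow> 'a \<Rightarrow> bool" where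
  "covered_by R p q \<longleftrightarrow> p \<in> R \<and> q \<in> R \<and> p < q \<and> \<not> (\<exists>z\<in>R. p < z \<and> z < q)"

definition max_below :: "nat \<Rightarrow> nat \<Rightarrow> labelling \<Rightarrow> nat \<times> nat \<Rightarrow> real" where
  "max_below r s x p =
     (let Q = {q. covered_by (rect r s) q p} in if Q = {} then 0 else Max (x ` Q))"

definition min_above :: "nat \<Rightarrow> nat \<Rightarrow> labelling \<Rightarrow> nat \<times> nat \<Rightarrow> real" where
  "min_above r s x p =
     (let Q = {q. covered_by (rect r s) p q} in if Q = {} then 1 else Min (x ` Q))"

definition toggle :: "nat \<Rightarrow> nat \<Rightarrow> nat \<times> nat \<Rightarrow> labelling \<Rightarrow> labelling" where
  "toggle r s p x = x(p := min_above r s x p + max_below r s x p - x p)"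

definition transfer :: "nat \<Rightarrow> nat \<Rightarrow> labelling \<Rightarrow> labelling" where
  "transfer r s x = (\<lambda>p. if p \<in> rect r s then x p - max_below r s x p else x p)"

text \<open>\<open>compose [f\<^sub>1, \<dots>, f\<^sub>n] = f\<^sub>1 \<circ> \<dots> \<circ> f\<^sub>n\<close>; the last function of the list is applied first.\<close>

definition compose :: "('a \<Rightarrow> 'a) list \<Rightarrow> 'a \<Rightarrow> 'a" where
  "compose fs = foldr (\<circ>) fs id"

definition linear_extension :: "'a::order set \<Rightarrow> ('a \<Rightarrow> nat) \<Rightarrow> bool" where
  "linear_extension I L \<longleftrightarrow>
     bij_betw L I {1..card I} \<and> (\<forall>p\<in>I. \<forall>q\<in>I. p \<le> q \<longrightarrow> L p \<le> L q)"

text \<open>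
  The result does not depend on the linear extension, since toggles at positions that do not
  cover one another commute; hence an arbitrary one is chosen.
\<close>

definition rho :: "nat \<Rightarrow> nat \<Rightarrow> (nat \<times> nat) set \<Rightarrow> labelling \<Rightarrow> labelling" where
  "rho r s I =
     (let L = (SOME L. linear_extension I L)
      in compose (map (\<lambda>i. toggle r s (inv_into I L i)) [1..<card I + 1]))"

definition RSK :: "nat \<Rightarrow> nat \<Rightarrow> labelling \<Rightarrow> labelling" where
  "RSK r s =
     compose (map (\<lambda>l. inv (rho r s (rect (r - l) (s - l)))) (rev [1..<min r s]))
       \<circ> inv (transfer r s)"

definition poset_file :: "nat \<Rightarrow> nat \<Rightarrow> int \<Rightarrow> (nat \<times> nat) set" where
  "poset_file r s k = {(a, b) \<in> rect r s. int a - int b = k}"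

definition Pro :: "nat \<Rightarrow> nat \<Rightarrow> nat \<Rightarrow> nat \<Rightarrow> labelling \<Rightarrow> labelling" where
  "Pro r s i j =
     compose (map (\<lambda>k. rho r s (poset_file r s k \<inter> rect i j)) [int i - int j + 1 .. int i - 1])"

definition Evac :: "nat \<Rightarrow> nat \<Rightarrow> labelling \<Rightarrow> labelling" where
  "Evac r s = compose (map (\<lambda>j. Pro r s r j) [2..<s + 1])"

definition lattice_step :: "nat \<times> nat \<Rightarrow> nat \<times> nat \<Rightarrow> bool" where
  "lattice_step p q \<longleftrightarrow> q = (fst p + 1, snd p) \<or> q = (fst p, snd p + 1)"

definition lattice_path :: "nat \<times> nat \<Rightarrow> nat \<times> nat \<Rightarrow> (nat \<times> nat) list \<Rightarrow> bool" where
  "lattice_path a b p \<longleftrightarrow> p \<noteq> [] \<and> hd p = a \<and> last p = b \<and> successively lattice_step p"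

text \<open>
  The paths are numbered from \<open>0\<close>, and path number \<open>i\<close> joins the \<open>i\<close>-th source to the \<open>i\<close>-th
  sink; as the paths are disjoint, no other matching of sources and sinks is possible.
\<close>

definition path_system ::
    "nat \<Rightarrow> nat \<Rightarrow> nat \<Rightarrow> nat \<Rightarrow> nat \<Rightarrow> (nat \<Rightarrow> (nat \<times> nat) list) \<Rightarrow> bool" where
  "path_system u1 v1 u2 v2 k P \<longleftrightarrow>
     (\<forall>i<k. lattice_path (u1, v1 + i) (u2, v2 + 1 + i - k) (P i)) \<and>
     (\<forall>i<k. \<forall>j<k. i \<noteq> j \<longrightarrow> set (P i) \<inter> set (P j) = {})"

text \<open>\<open>H u1 v1 u2 v2 x k\<close> is meant for \<open>u1 \<le> u2\<close> and \<open>v1 \<le> v2\<close> only.\<close>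

definition H :: "nat \<Rightarrow> nat \<Rightarrow> nat \<Rightarrow> nat \<Rightarrow> labelling \<Rightarrow> nat \<Rightarrow> real" where
  "H u1 v1 u2 v2 x k =
     (let k' = min k (min (u2 - u1 + 1) (v2 - v1 + 1))
      in Max {\<Sum>p\<in>(\<Union>i<k'. set (P i)). x p | P. path_system u1 v1 u2 v2 k' P})"

end

theory Submission
  imports Defs
begin

text \<open>A system of \<open>k\<close> disjoint paths is encoded by an integer height function subject only to
  upper bounds on differences of adjacent values, its weight being linear in the heights. Write
  \<open>h u v k\<close> for the maximal weight of \<open>k\<close> paths in the columns \<open>u, \<dots>, v\<close>. Averaging two height
  functions, rounded down and up, and conversely exchanging two of them on a connected component
  of the region where one exceeds the other, gives the octahedron relation
  \<open>h u v k + h (u+1) (v+1) k = max (h (u+1) v k + h u (v+1) k) (h (u+1) v (k-1) + h u (v+1) (k+1))\<close>.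
  Such an exchange is possible because a walk joining the two ends of the region and a walk
  separating them must meet.

  Passing from \<open>h\<close> to its increments in \<open>k\<close> (the parts of a shape), the relation becomes the toggle
  rule. Applied to corners it shows that RSK lists the parts of the shapes of initial rectangles;
  applied to intervals of columns it shows that evacuation replaces the shapes of the
  initial intervals by those of the final ones, that is, by the shapes of the rotated labelling.
  Finally the relation determines \<open>h\<close> on all intervals from its values on the initial ones.\<close>

text \<open>Height functions are used because each of their constraints bounds the difference of two
  integers at adjacent corners. Such constraints survive rounded averaging and piecewise exchange,
  so paths never have to be rerouted one by one. The three kinds of constraints make the corners a
  triangulated grid, in which a connected set going up and a walk going across cannot avoid each
  other. This dichotomy is the source of the two terms of the maximum: either an exchange keeps both
  numbers of paths, or the region reaches from the sources to the sinks, and then a shift by one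
  beyond it moves one path from the short interval to the long one.

  The relation is available only while \<open>k\<close> is smaller than both side lengths. For the
  largest \<open>k\<close> every vertex is used and total sums take over; the terms that drop out
  are exactly the neighbours missing in a toggle at the border.

  Statement (a) rests on the positions that evacuation leaves alone: they hold the shapes of [i] x
  [s], and the reconstruction from initial intervals is applied to the transposed labelling.\<close>

subsection \<open>Crossing walks\<close>

text \<open>Points are adjacent if \<open>feasible\<close> below relates their heights.\<close>

definition adj :: "nat \<times> nat \<Rightarrow> nat \<times> nat \<Rightarrow> bool" where
  "adj p q \<longleftrightarrow> (case (p, q) of ((i, c), (j, d)) \<Rightarrow>
     (j = i \<and> (d = Suc c \<or> c = Suc d)) \<or> (d = c \<and> (j = Suc i \<or> i = Suc j)) \<or>
     (i = Suc j \<and> d = Suc c) \<or> (j = Suc i \<and> c = Suc d))"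

text \<open>The signed intersection of step \<open>m\<close> with the ray that starts beside
  \<open>(i, c)\<close>, between columns \<open>c\<close> and \<open>c + 1\<close>, and runs towards
  larger rows. An edge meets this ray iff its left end lies in a row larger than \<open>i\<close>.
  Summed over a walk it is an intersection number.\<close>

definition crossing :: "(nat \<Rightarrow> nat \<times> nat) \<Rightarrow> nat \<Rightarrow> nat \<Rightarrow> nat \<Rightarrow> int" where
  "crossing q i c m =
     (if fst (q m) > i \<and> snd (q m) = c \<and> snd (q (Suc m)) = Suc c then 1
      else if fst (q (Suc m)) > i \<and> snd (q (Suc m)) = c \<and> snd (q m) = Suc c then - 1 else 0)"

lemma crossing_down:
  assumes "q m \<noteq> (Suc i, c)" "q (Suc m) \<noteq> (Suc i, c)"
  shows "crossing q (Suc i) c m = crossing q i c m"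
  using assms by (cases "q m"; cases "q (Suc m)") (auto simp: crossing_def)

lemma crossing_right:
  assumes "adj (q m) (q (Suc m))" "q m \<noteq> (i, Suc c)" "q (Suc m) \<noteq> (i, Suc c)"
  shows "crossing q i c m - crossing q i (Suc c) m =
     of_bool (snd (q (Suc m)) = Suc c \<and> fst (q (Suc m)) > i) - of_bool (snd (q m) = Suc c \<and> fst (q m) > i)"
  using assms by (cases "q m"; cases "q (Suc m)") (auto simp: crossing_def adj_def)

lemma crossing_diag:
  assumes "adj (q m) (q (Suc m))" "q m \<noteq> (i, Suc c)" "q (Suc m) \<noteq> (i, Suc c)"
    "q m \<noteq> (Suc i, c)" "q (Suc m) \<noteq> (Suc i, c)"
  shows "crossing q (Suc i) c m - crossing q i (Suc c) m =
     of_bool (snd (q (Suc m)) = Suc c \<and> fst (q (Suc m)) > i) - of_bool (snd (q m) = Suc c \<and> fst (q m) > i)"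
  using assms by (cases "q m"; cases "q (Suc m)") (auto simp: crossing_def adj_def)

text \<open>The intersection number is locally constant off the walk. Moving the base point within a
  column affects only edges with left end at one of the two points. Moving it between columns
  changes the sum by a telescoping series of indicators of one column, and both ends of the walk lie
  outside that column.\<close>

lemma sum_crossing_adj:
  assumes walk: "\<And>m. m < n \<Longrightarrow> adj (q m) (q (Suc m))"
    and p: "\<And>m. m \<le> n \<Longrightarrow> q m \<noteq> p" "snd p \<noteq> snd (q 0)" "snd p \<noteq> snd (q n)"
    and p': "\<And>m. m \<le> n \<Longrightarrow> q m \<noteq> p'" "snd p' \<noteq> snd (q 0)" "snd p' \<noteq> snd (q n)"
    and "adj p p'"
  shows "(\<Sum>m<n. crossing q (fst p) (snd p) m) = (\<Sum>m<n. crossing q (fst p') (snd p') m)"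
proof -
  let ?F = "\<lambda>i c. \<Sum>m<n. crossing q i c m"
  have down: "?F i c = ?F (Suc i) c" if "\<And>m. m \<le> n \<Longrightarrow> q m \<noteq> (Suc i, c)" for i c
    by (rule sum.cong) (use that crossing_down in auto)
  have tele: "(\<Sum>m<n. of_bool (snd (q (Suc m)) = Suc c \<and> fst (q (Suc m)) > i)
      - of_bool (snd (q m) = Suc c \<and> fst (q m) > i)) = (0 :: int)"
    if "Suc c \<noteq> snd (q 0)" "Suc c \<noteq> snd (q n)" for i c
    using that by (subst sum_lessThan_telescope) auto
  have right: "?F i c = ?F i (Suc c)" if "\<And>m. m \<le> n \<Longrightarrow> q m \<noteq> (i, Suc c)"
    "Suc c \<noteq> snd (q 0)" "Suc c \<noteq> snd (q n)" for i c
  proof -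
    have "?F i c - ?F i (Suc c) = 0"
      unfolding sum_subtractf[symmetric] using that walk
      by (subst tele[OF that(2,3), of i, symmetric]) (intro sum.cong crossing_right, auto)
    then show ?thesis by simp
  qed
  have diag: "?F (Suc i) c = ?F i (Suc c)" if "\<And>m. m \<le> n \<Longrightarrow> q m \<noteq> (i, Suc c)"
    "\<And>m. m \<le> n \<Longrightarrow> q m \<noteq> (Suc i, c)" "Suc c \<noteq> snd (q 0)" "Suc c \<noteq> snd (q n)" for i c
  proof -
    have "?F (Suc i) c - ?F i (Suc c) = 0"
      unfolding sum_subtractf[symmetric] using that walk
      by (subst tele[OF that(3,4), of i, symmetric]) (intro sum.cong crossing_diag, auto)
    then show ?thesis by simp
  qed
  obtain i c j d where pp: "p = (i, c)" "p' = (j, d)" by (metis surj_pair)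
  from \<open>adj p p'\<close> consider "j = i" "d = Suc c" | "j = i" "c = Suc d" | "d = c" "j = Suc i" |
    "d = c" "i = Suc j" | "i = Suc j" "d = Suc c" | "j = Suc i" "c = Suc d"
    by (auto simp: adj_def pp)
  then show ?thesis
  proof cases
    case 1 then show ?thesis using right[of i c] p p' pp by simp
  next case 2 then show ?thesis using right[of i d] p p' pp by simp
  next case 3 then show ?thesis using down[of i c] p p' pp by simp
  next case 4 then show ?thesis using down[of j c] p p' pp by simp
  next case 5 then show ?thesis using diag[of j c] p p' pp by simp
  next case 6 then show ?thesis using diag[of i d] p p' pp by simp
  qed
qed

text \<open>A discrete Jordan argument: along the connected set \<open>P\<close> the intersection
  number is constant, yet it is 0 at \<open>p1\<close>, beyond whose row the walk never gets, and 1
  at \<open>p0\<close>.\<close>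

lemma no_crossing:
  assumes walk: "\<And>m. m < n \<Longrightarrow> adj (q m) (q (Suc m))"
    and disj: "\<And>m. m \<le> n \<Longrightarrow> q m \<notin> P"
    and cols: "\<And>p. p \<in> P \<Longrightarrow> snd (q 0) < snd p \<and> snd p < snd (q n)"
    and reach: "(p0, p1) \<in> {(p, p'). adj p p' \<and> p \<in> P \<and> p' \<in> P}\<^sup>*"
    and p0: "p0 \<in> P" "fst p0 = 0"
    and p1: "\<And>m. m \<le> n \<Longrightarrow> fst (q m) \<le> fst p1"
  shows False
proof -
  let ?F = "\<lambda>p. \<Sum>m<n. crossing q (fst p) (snd p) m"
  have "?F p1 = ?F p0"
    using reach
  proof (induction rule: rtrancl_induct)
    case (step p p')
    then have P: "p \<in> P" "p' \<in> P" and "adj p p'" by auto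
    have "?F p = ?F p'"
      using disj P cols[OF P(1)] cols[OF P(2)]
      by (intro sum_crossing_adj[of n q p p'] walk \<open>adj p p'\<close>) auto
    with step show ?case by simp
  qed simp
  moreover have "crossing q (fst p1) (snd p1) m = 0" if "m < n" for m
    using p1[of m] p1[of "Suc m"] that by (auto simp: crossing_def)
  then have "?F p1 = 0" by simp
  moreover have "?F p0 = 1"
  proof -
    \<comment> \<open>In row 0 the only left end not counted in this column is \<open>p0\<close>
      itself, which the walk avoids. So every passage between the two columns counts.\<close>
    have "crossing q (fst p0) (snd p0) m =
        of_bool (snd (q (Suc m)) > snd p0) - of_bool (snd (q m) > snd p0)" if "m < n" for m
      using walk[OF that] disj[of m] disj[of "Suc m"] that p0
      by (cases "q m"; cases "q (Suc m)"; cases p0) (auto simp: crossing_def adj_def less_Suc_eq)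
    then have "?F p0 = (\<Sum>m<n. of_bool (snd (q (Suc m)) > snd p0) - of_bool (snd (q m) > snd p0))"
      by simp
    also have "\<dots> = of_bool (snd (q n) > snd p0) - of_bool (snd (q 0) > snd p0)"
      by (rule sum_lessThan_telescope)
    finally show ?thesis using cols[OF p0(1)] by simp
  qed
  ultimately show False by simp
qed

subsection \<open>Height functions\<close>

text \<open>A height function lives on the corners of the unit cells: cell \<open>(i, c)\<close> has the corners
  \<open>(i, c)\<close> and \<open>(i + 1, c + 1)\<close>, and \<open>M i c\<close> counts the paths that enter row \<open>i\<close> in a column
  smaller than \<open>c\<close>. The vertex \<open>(i, c)\<close> lies on a path iff \<open>M i (c + 1) - M (i + 1) c = 1\<close>.\<close>

definition feasible :: "(nat \<Rightarrow> nat \<Rightarrow> int) \<Rightarrow> bool" where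
  "feasible M \<longleftrightarrow>
     (\<forall>i c. M i c \<le> M i (Suc c) \<and> M (Suc i) c \<le> M i c \<and> M i (Suc c) \<le> M (Suc i) c + 1)"

text \<open>If \<open>k\<close> endpoints occupy the columns \<open>d, ..., d + k - 1\<close>, then
  \<open>ramp k (c - d)\<close> of them lie in columns smaller than \<open>c\<close>. The sources
  have \<open>d = u\<close>, the sinks \<open>d = v + 1 - k\<close>.\<close>

definition ramp :: "nat \<Rightarrow> int \<Rightarrow> int" where
  "ramp k z = min (int k) (max 0 z)"

text \<open>The rows up to \<open>a\<close> are frozen at the sources and those beyond
  \<open>b\<close> at the sinks. At the left and right borders monotonicity squeezes the values
  between these frozen rows.\<close>

definition heights :: "nat \<Rightarrow> nat \<Rightarrow> nat \<Rightarrow> nat \<Rightarrow> nat \<Rightarrow> (nat \<Rightarrow> nat \<Rightarrow> int) set" where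
  "heights a u b v k = {M. feasible M \<and>
     (\<forall>i\<le>a. \<forall>c. M i c = ramp k (int c - int u)) \<and>
     (\<forall>i>b. \<forall>c. M i c = ramp k (int c - int v - 1 + int k))}"

text \<open>The column set is a parameter so that systems in different intervals can be weighed over
  one common range; see \<open>weight_cong_cols\<close>.\<close>

definition weight :: "nat \<Rightarrow> nat \<Rightarrow> nat set \<Rightarrow> labelling \<Rightarrow> (nat \<Rightarrow> nat \<Rightarrow> int) \<Rightarrow> real" where
  "weight a b C x M = (\<Sum>i\<in>{a..b}. \<Sum>c\<in>C. x (i, c) * of_int (M i (Suc c) - M (Suc i) c))"

lemma ramp_mono: "y \<le> z \<Longrightarrow> ramp k y \<le> ramp k z"
  by (auto simp: ramp_def)

lemma ramp_step: "ramp k (z + 1) \<le> ramp k z + 1"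
  by (auto simp: ramp_def)

lemma ramp_nonpos: "z \<le> 0 \<Longrightarrow> ramp k z = 0"
  by (simp add: ramp_def)

lemma ramp_Suc: "1 \<le> z \<Longrightarrow> ramp (Suc k) z = ramp k (z - 1) + 1"
  by (auto simp: ramp_def)

lemma feasibleD:
  assumes "feasible M"
  shows "M i c \<le> M i (Suc c)" "M (Suc i) c \<le> M i c" "M i (Suc c) \<le> M (Suc i) c + 1"
  using assms by (auto simp: feasible_def)

lemma feasible_mono:
  assumes "feasible M"
  shows "c \<le> d \<Longrightarrow> M i c \<le> M i d" "i \<le> j \<Longrightarrow> M j c \<le> M i c"
proof -
  show "c \<le> d \<Longrightarrow> M i c \<le> M i d"
    using lift_Suc_mono_le[of "M i"] feasibleD(1)[OF assms] by blast
  show "i \<le> j \<Longrightarrow> M j c \<le> M i c"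
    using lift_Suc_antimono_le[of "\<lambda>i. M i c"] feasibleD(2)[OF assms] by blast
qed

lemma feasible_step: "feasible M \<Longrightarrow> M i (Suc c) - M (Suc i) c \<in> {0, 1}"
  using feasibleD[of M i c] feasibleD[of M i "c"] feasibleD(1)[of M "Suc i" c] by force

lemma heightsD:
  assumes "M \<in> heights a u b v k"
  shows "feasible M" "i \<le> a \<Longrightarrow> M i c = ramp k (int c - int u)"
    "i > b \<Longrightarrow> M i c = ramp k (int c - int v - 1 + int k)"
  using assms by (auto simp: heights_def)

lemma heightsI:
  assumes "feasible M" "\<And>i c. i \<le> a \<Longrightarrow> M i c = ramp k (int c - int u)"
    "\<And>i c. i > b \<Longrightarrow> M i c = ramp k (int c - int v - 1 + int k)"
  shows "M \<in> heights a u b v k"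
  using assms by (auto simp: heights_def)

lemma heights_left:
  assumes M: "M \<in> heights a u b v k" and "c \<le> u" "u + k \<le> Suc v"
  shows "M i c = 0"
proof -
  have "M (max i (Suc b)) c = 0" "M (min i a) c = 0"
    using assms by (auto simp: heightsD(2,3)[OF M] ramp_def)
  moreover have "M (max i (Suc b)) c \<le> M i c" "M i c \<le> M (min i a) c"
    by (auto intro!: feasible_mono heightsD(1)[OF M])
  ultimately show ?thesis by linarith
qed

lemma heights_right:
  assumes M: "M \<in> heights a u b v k" and "c > v" "u + k \<le> Suc v"
  shows "M i c = int k"
proof -
  have "M (max i (Suc b)) c = k" "M (min i a) c = k"
    using assms by (auto simp: heightsD(2,3)[OF M] ramp_def)
  moreover have "M (max i (Suc b)) c \<le> M i c" "M i c \<le> M (min i a) c"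
    by (auto intro!: feasible_mono heightsD(1)[OF M])
  ultimately show ?thesis by linarith
qed

lemma weight_cong_cols:
  assumes M: "M \<in> heights a u b v k" and "u + k \<le> Suc v" and C: "finite C" "{u..v} \<subseteq> C"
  shows "weight a b C x M = weight a b {u..v} x M"
proof -
  have "M i (Suc c) - M (Suc i) c = 0" if "c \<in> C - {u..v}" for i c
  proof (cases "c < u")
    case True
    then show ?thesis using heights_left[OF M _ assms(2)] by simp
  next
    case False
    then show ?thesis using heights_right[OF M _ assms(2)] that by simp
  qed
  then show ?thesis unfolding weight_def
    by (intro sum.cong sum.mono_neutral_right C refl) auto
qed

lemma weight_add:
  assumes "\<And>i c. A i c + B i c = A' i c + B' i c"
  shows "weight a b C x A + weight a b C x B = weight a b C x A' + weight a b C x B'"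
proof -
  have "weight a b C x A + weight a b C x B =
      (\<Sum>i\<in>{a..b}. \<Sum>c\<in>C. x (i, c) * of_int ((A i (Suc c) + B i (Suc c)) - (A (Suc i) c + B (Suc i) c)))"
    for A B by (simp add: weight_def algebra_simps sum.distrib sum_subtractf)
  then show ?thesis by (simp only: assms)
qed

section \<open>Existence of systems and their maximal weight\<close>

lemma heights_nonempty:
  assumes "k \<le> Suc b - a" "u + k \<le> Suc v"
  shows "heights a u b v k \<noteq> {}"
proof -
  let ?M = "\<lambda>i c. max (ramp k (int c - int v - 1 + int k))
      (ramp k (int c + int (i - a) - int u) - int (i - a))"
  have "?M \<in> heights a u b v k"
    using assms unfolding heights_def feasible_def
  proof (intro CollectI conjI allI impI)
    fix i c
    show "?M i c \<le> ?M i (Suc c)"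
      by (intro max.mono diff_right_mono ramp_mono) auto
    have "ramp k (int c + 1 + int (i - a) - int u) \<le> ramp k (int c + int (i - a) - int u) + 1"
      using ramp_step[of k "int c + int (i - a) - int u"] by (simp add: algebra_simps)
    then show "?M (Suc i) c \<le> ?M i c"
      by (cases "i < a") (auto simp: Suc_diff_le not_less algebra_simps max_def)
    have "ramp k (int (Suc c) - int v - 1 + int k) \<le> ramp k (int c - int v - 1 + int k) + 1"
      using ramp_step[of k "int c - int v - 1 + int k"] by (simp add: algebra_simps)
    moreover have "ramp k (int c + 1 - int u) \<le> ramp k (int c - int u) + 1"
      using ramp_step[of k "int c - int u"] by (simp add: algebra_simps)
    ultimately show "?M i (Suc c) \<le> ?M (Suc i) c + 1"
      by (cases "i < a") (auto simp: Suc_diff_le not_less algebra_simps max_def)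
  next
    fix i c assume "i \<le> a"
    then show "?M i c = ramp k (int c - int u)" using assms by (auto simp: ramp_def)
  next
    fix i c assume "b < i"
    then have "k \<le> i - a" using assms by simp
    then have "ramp k z - int (i - a) \<le> 0" "0 \<le> ramp k z" for z by (auto simp: ramp_def)
    then show "?M i c = ramp k (int c - int v - 1 + int k)" by (meson max.absorb1 order_trans)
  qed
  then show ?thesis by blast
qed

text \<open>Increments are 0 or 1, so a weight is the label sum of a subset of a finite rectangle.
  For infinite \<open>C\<close> all sums default to 0.\<close>

lemma weight_finite: "finite (weight a b C x ` heights a u b v k)"
proof (cases "finite C")
  case True
  have "weight a b C x M \<in> sum x ` Pow ({a..b} \<times> C)" if "M \<in> heights a u b v k" for M
  proof -
    let ?U = "{(i, c) \<in> {a..b} \<times> C. M i (Suc c) - M (Suc i) c = 1}"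
    have "x (i, c) * of_int (M i (Suc c) - M (Suc i) c) =
        (if M i (Suc c) - M (Suc i) c = 1 then x (i, c) else 0)" for i c
      using feasible_step[OF heightsD(1)[OF that], of i c] by auto
    then have "weight a b C x M = (\<Sum>(i, c)\<in>{a..b} \<times> C. if M i (Suc c) - M (Suc i) c = 1 then x (i, c) else 0)"
      by (simp add: weight_def sum.cartesian_product)
    also have "\<dots> = sum x ?U"
      using True by (intro sum.mono_neutral_cong_right) (auto split: if_splits)
    finally show ?thesis by blast
  qed
  then have "weight a b C x ` heights a u b v k \<subseteq> sum x ` Pow ({a..b} \<times> C)" by blast
  then show ?thesis by (rule finite_subset) (use True in simp)
qed (simp add: weight_def image_constant_conv)

text \<open>The statistic \<open>H\<close> without its cap on \<open>k\<close>. Without any system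
  this would be \<open>Max\<close> of the empty set, hence the recurring bounds
  \<open>k <= Suc b - a\<close> and \<open>u + k <= Suc v\<close>. The empty interval
  \<open>u = Suc v\<close> with \<open>k = 0\<close> is allowed and serves as a base case.\<close>

definition hmax :: "nat \<Rightarrow> nat \<Rightarrow> nat \<Rightarrow> nat \<Rightarrow> labelling \<Rightarrow> nat \<Rightarrow> real" where
  "hmax a u b v x k = Max (weight a b {u..v} x ` heights a u b v k)"

lemma hmax_ge: "M \<in> heights a u b v k \<Longrightarrow> weight a b {u..v} x M \<le> hmax a u b v x k"
  unfolding hmax_def by (intro Max_ge weight_finite imageI)

lemma hmax_attained:
  assumes "k \<le> Suc b - a" "u + k \<le> Suc v"
  obtains M where "M \<in> heights a u b v k" "weight a b {u..v} x M = hmax a u b v x k"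
proof -
  have "hmax a u b v x k \<in> weight a b {u..v} x ` heights a u b v k"
    unfolding hmax_def by (intro Max_in weight_finite) (simp add: heights_nonempty[OF assms])
  then show thesis using that by auto
qed

text \<open>Discrete midpoint convexity: if both functions satisfy a bound \<open>d\<close> on a
  difference, their sum satisfies \<open>2 * d\<close>, and integer halving commutes with adding
  \<open>2 * d\<close>.\<close>

lemma feasible_average:
  assumes "feasible A" "feasible B"
  shows "feasible (\<lambda>i c. (A i c + B i c) div 2)" "feasible (\<lambda>i c. (A i c + B i c + 1) div 2)"
proof -
  note D = feasibleD[OF assms(1)] feasibleD[OF assms(2)]
  show "feasible (\<lambda>i c. (A i c + B i c) div 2)"
    unfolding feasible_def
  proof (intro allI, goal_cases)
    case (1 i c)
    show ?case using D[of i c] by (intro conjI; linarith)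
  qed
  show "feasible (\<lambda>i c. (A i c + B i c + 1) div 2)"
    unfolding feasible_def
  proof (intro allI, goal_cases)
    case (1 i c)
    show ?case using D[of i c] by (intro conjI; linarith)
  qed
qed

text \<open>Both gluing rules rely on the fact that every constraint of \<^const>\<open>feasible\<close> bounds a
  difference of two values at adjacent points.\<close>

lemma feasible_swap:
  assumes "feasible A" "feasible B"
    and X: "\<And>i c j d. adj (i, c) (j, d) \<Longrightarrow> (i, c) \<in> X \<Longrightarrow> (j, d) \<notin> X \<Longrightarrow> A i c > B i c \<and> A j d \<le> B j d"
  shows "feasible (\<lambda>i c. if (i, c) \<in> X then B i c else A i c)"
    "feasible (\<lambda>i c. if (i, c) \<in> X then A i c else B i c)"
proof -
  have a: "adj (i, c) (i, Suc c)" "adj (i, Suc c) (i, c)" "adj (Suc i, c) (i, c)" "adj (i, c) (Suc i, c)"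
    "adj (i, Suc c) (Suc i, c)" "adj (Suc i, c) (i, Suc c)" for i c by (auto simp: adj_def)
  note D = feasibleD[OF assms(1)] feasibleD[OF assms(2)]
  show "feasible (\<lambda>i c. if (i, c) \<in> X then B i c else A i c)"
    unfolding feasible_def
  proof (intro allI, goal_cases)
    case (1 i c)
    show ?case
      using D[of i c] X[OF a(1), of i c] X[OF a(2), of i c] X[OF a(3), of i c] X[OF a(4), of i c]
        X[OF a(5), of i c] X[OF a(6), of i c]
      by (auto split: if_splits)
  qed
  show "feasible (\<lambda>i c. if (i, c) \<in> X then A i c else B i c)"
    unfolding feasible_def
  proof (intro allI, goal_cases)
    case (1 i c)
    show ?case
      using D[of i c] X[OF a(1), of i c] X[OF a(2), of i c] X[OF a(3), of i c] X[OF a(4), of i c]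
        X[OF a(5), of i c] X[OF a(6), of i c]
      by (auto split: if_splits)
  qed
qed

text \<open>Across the boundary of \<open>X\<close>, from \<open>p\<close> inside to
  \<open>q\<close> outside, \<open>A p <= B p\<close> and \<open>B q <= A q - 1\<close>. Hence the
  bound that tightens for the lowered \<open>A\<close> is inherited from \<open>B\<close>, and the
  one that tightens for the raised \<open>B\<close> from \<open>A\<close>.\<close>

lemma feasible_shift:
  assumes "feasible A" "feasible B"
    and X: "\<And>i c j d. adj (i, c) (j, d) \<Longrightarrow> (i, c) \<in> X \<Longrightarrow> (j, d) \<notin> X \<Longrightarrow> A i c \<le> B i c \<and> A j d > B j d"
  shows "feasible (\<lambda>i c. if (i, c) \<in> X then A i c else A i c - 1)"
    "feasible (\<lambda>i c. if (i, c) \<in> X then B i c else B i c + 1)"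
proof -
  have a: "adj (i, c) (i, Suc c)" "adj (i, Suc c) (i, c)" "adj (Suc i, c) (i, c)" "adj (i, c) (Suc i, c)"
    "adj (i, Suc c) (Suc i, c)" "adj (Suc i, c) (i, Suc c)" for i c by (auto simp: adj_def)
  note D = feasibleD[OF assms(1)] feasibleD[OF assms(2)]
  show "feasible (\<lambda>i c. if (i, c) \<in> X then A i c else A i c - 1)"
    unfolding feasible_def
  proof (intro allI, goal_cases)
    case (1 i c)
    show ?case
      using D[of i c] X[OF a(1), of i c] X[OF a(2), of i c] X[OF a(3), of i c] X[OF a(4), of i c]
        X[OF a(5), of i c] X[OF a(6), of i c]
      by (auto split: if_splits)
  qed
  show "feasible (\<lambda>i c. if (i, c) \<in> X then B i c else B i c + 1)"
    unfolding feasible_def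
  proof (intro allI, goal_cases)
    case (1 i c)
    show ?case
      using D[of i c] X[OF a(1), of i c] X[OF a(2), of i c] X[OF a(3), of i c] X[OF a(4), of i c]
        X[OF a(5), of i c] X[OF a(6), of i c]
      by (auto split: if_splits)
  qed
qed

subsection \<open>The octahedron relation\<close>

definition reach :: "(nat \<times> nat) set \<Rightarrow> nat \<times> nat \<Rightarrow> (nat \<times> nat) set" where
  "reach P p = {q. (p, q) \<in> {(p, q). adj p q \<and> p \<in> P \<and> q \<in> P}\<^sup>*}"

lemma reach_refl: "p \<in> reach P p"
  by (simp add: reach_def)

lemma reach_step: "p \<in> reach P p0 \<Longrightarrow> adj p q \<Longrightarrow> p \<in> P \<Longrightarrow> q \<in> P \<Longrightarrow> q \<in> reach P p0"
  by (auto simp: reach_def intro: rtrancl_into_rtrancl)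

lemma reach_subset:
  assumes "p0 \<in> P" shows "reach P p0 \<subseteq> P"
proof
  fix q assume "q \<in> reach P p0"
  then have "(p0, q) \<in> {(p, q). adj p q \<and> p \<in> P \<and> q \<in> P}\<^sup>*" by (simp add: reach_def)
  then show "q \<in> P" by (induction rule: rtrancl_induct) (use assms in auto)
qed

lemma reach_row:
  assumes "(i, c) \<in> reach P p0" "c \<le> d" "\<And>e. c \<le> e \<Longrightarrow> e \<le> d \<Longrightarrow> (i, e) \<in> P"
  shows "(i, d) \<in> reach P p0"
  using assms(2,3)
proof (induction d rule: dec_induct)
  case (step d)
  show ?case by (rule reach_step[OF step.IH]) (use step in \<open>auto simp: adj_def\<close>)
qed (use assms in simp)

lemma reach_col:
  assumes "(i, c) \<in> reach P p0" "i \<le> j" "\<And>e. i \<le> e \<Longrightarrow> e \<le> j \<Longrightarrow> (e, c) \<in> P"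
  shows "(j, c) \<in> reach P p0"
  using assms(2,3)
proof (induction j rule: dec_induct)
  case (step j)
  show ?case by (rule reach_step[OF step.IH]) (use step in \<open>auto simp: adj_def\<close>)
qed (use assms in simp)

text \<open>\<open>no_crossing\<close> asks for a point of \<open>P\<close> at least as high as the
  whole walk. A walk is finite, so the component of \<open>P\<close> can be prolonged along column
  \<open>c\<close> until it is high enough.\<close>

lemma no_double_crossing:
  assumes p0: "p0 \<in> P" "fst p0 = 0" and "q0 \<notin> P"
    and cols: "\<And>p. p \<in> P \<Longrightarrow> snd q0 < snd p \<and> snd p < snd q1"
    and q1: "q1 \<in> reach (- P) q0"
    and p1: "(i, c) \<in> reach P p0" and top: "\<And>j. i \<le> j \<Longrightarrow> (j, c) \<in> P"
  shows False
proof -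
  obtain n q where q: "q 0 = q0" "q n = q1" "\<And>m. m < n \<Longrightarrow> adj (q m) (q (Suc m)) \<and> q m \<notin> P \<and> q (Suc m) \<notin> P"
    using q1 by (auto simp: reach_def rtrancl_power relpow_fun_conv)
  define j where "j = Max (insert i ((\<lambda>m. fst (q m)) ` {..n}))"
  have "fst (q m) \<le> j" if "m \<le> n" for m
    unfolding j_def by (rule Max_ge) (use that in auto)
  moreover have "i \<le> j" unfolding j_def by (rule Max_ge) auto
  then have "(j, c) \<in> reach P p0"
    by (rule reach_col[OF p1]) (use top in auto)
  moreover have "q m \<notin> P" if "m \<le> n" for m
    using q(3)[of "m - 1"] q(1) assms(3) that by (cases m) auto
  ultimately show False
    using no_crossing[of n q P p0 "(j, c)"] q cols p0 by (auto simp: reach_def)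
qed

section \<open>The two inequalities of the octahedron relation\<close>

lemma hmax_ge':
  assumes "M \<in> heights a u b v k" "u + k \<le> Suc v" "finite C" "{u..v} \<subseteq> C"
  shows "weight a b C x M \<le> hmax a u b v x k"
  using weight_cong_cols[OF assms] hmax_ge[OF assms(1)] by simp

text \<open>By \<open>bot\<close> and \<open>top\<close> the boundary ramps of \<open>A\<close> and
  \<open>B\<close> add up to those of the intervals \<open>u..v\<close> and
  \<open>Suc u..Suc v\<close>. The latter two differ by 0 or 1, so rounding the half-sum up and down
  recovers them. Keeping the given systems general covers both terms of the maximum.\<close>

lemma hmax_average:
  assumes A: "A \<in> heights a u\<^sub>1 b v\<^sub>1 k\<^sub>1" and B: "B \<in> heights a u\<^sub>2 b v\<^sub>2 k\<^sub>2" and k: "u + k \<le> Suc v"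
    and bot: "\<And>c. ramp k\<^sub>1 (int c - int u\<^sub>1) + ramp k\<^sub>2 (int c - int u\<^sub>2) =
      ramp k (int c - int u) + ramp k (int c - int (Suc u))"
    and top: "\<And>c. ramp k\<^sub>1 (int c - int v\<^sub>1 - 1 + int k\<^sub>1) + ramp k\<^sub>2 (int c - int v\<^sub>2 - 1 + int k\<^sub>2) =
      ramp k (int c - int v - 1 + int k) + ramp k (int c - int (Suc v) - 1 + int k)"
  shows "weight a b {u..Suc v} x A + weight a b {u..Suc v} x B \<le>
    hmax a u b v x k + hmax a (Suc u) b (Suc v) x k"
proof -
  let ?F = "\<lambda>i c. (A i c + B i c) div 2" and ?G = "\<lambda>i c. (A i c + B i c + 1) div 2"
  have half: "(y + z) div 2 = z" "(y + z + 1) div 2 = y" if "z \<le> y" "y \<le> z + 1" for y z :: int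
    using that by linarith+
  have step: "ramp k (z - 1) \<le> ramp k z" "ramp k z \<le> ramp k (z - 1) + 1" for z
    using ramp_mono[of "z - 1" z k] ramp_step[of k "z - 1"] by auto
  have bot': "ramp k (int c - int (Suc u)) \<le> ramp k (int c - int u)"
    "ramp k (int c - int u) \<le> ramp k (int c - int (Suc u)) + 1" for c
    using step[of "int c - int u"] by (simp_all add: algebra_simps)
  have top': "ramp k (int c - int (Suc v) - 1 + int k) \<le> ramp k (int c - int v - 1 + int k)"
    "ramp k (int c - int v - 1 + int k) \<le> ramp k (int c - int (Suc v) - 1 + int k) + 1" for c
    using step[of "int c - int v - 1 + int k"] by (simp_all add: algebra_simps)
  have "?G \<in> heights a u b v k"
    unfolding heights_def mem_Collect_eq
    by (intro conjI allI impI feasible_average heightsD(1)[OF A] heightsD(1)[OF B])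
      (simp_all only: heightsD(2,3)[OF A] heightsD(2,3)[OF B] bot top half[OF bot'] half[OF top'])
  moreover have "?F \<in> heights a (Suc u) b (Suc v) k"
    unfolding heights_def mem_Collect_eq
    by (intro conjI allI impI feasible_average heightsD(1)[OF A] heightsD(1)[OF B])
      (simp_all only: heightsD(2,3)[OF A] heightsD(2,3)[OF B] bot top half[OF bot'] half[OF top'])
  moreover have "A i c + B i c = ?G i c + ?F i c" for i c by linarith
  then have "weight a b {u..Suc v} x A + weight a b {u..Suc v} x B =
      weight a b {u..Suc v} x ?G + weight a b {u..Suc v} x ?F" by (rule weight_add)
  ultimately show ?thesis
    using hmax_ge'[of ?G a u b v k "{u..Suc v}" x] hmax_ge'[of ?F a "Suc u" b "Suc v" k "{u..Suc v}" x] k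
    by auto
qed

lemma hmax_octahedron_le:
  assumes A: "A \<in> heights a u b v k" and B: "B \<in> heights a (Suc u) b (Suc v) k"
    and k: "1 \<le> k" "u + k \<le> v" and ab: "a \<le> b"
  shows "weight a b {u..Suc v} x A + weight a b {u..Suc v} x B \<le>
    max (hmax a (Suc u) b v x k + hmax a u b (Suc v) x k)
        (hmax a (Suc u) b v x (k - 1) + hmax a u b (Suc v) x (k + 1))"
proof -
  define P where "P = {(i, c). B i c < A i c}"
  have P: "(i, c) \<in> P \<longleftrightarrow> B i c < A i c" for i c by (simp add: P_def)
  note hA = heightsD(2,3)[OF A] and hB = heightsD(2,3)[OF B]
  have left: "A i c = 0" "B i c = 0" if "c \<le> u" for i c
    using heights_left[OF A] heights_left[OF B] that k by auto
  have right: "A i c = k" "B i c = k" if "c > Suc v" for i c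
    using heights_right[OF A] heights_right[OF B] that k by auto
  have P_cols: "u < c \<and> c \<le> Suc v" if "(i, c) \<in> P" for i c
    using left[of c i] right[of c i] that by (cases "c \<le> u"; cases "c > Suc v") (auto simp: P)
  have P_bot: "(i, c) \<in> P \<longleftrightarrow> u < c \<and> c \<le> u + k" if "i \<le> a" for i c
    using that by (auto simp: P hA hB ramp_def)
  have P_top: "(i, c) \<in> P \<longleftrightarrow> Suc v < c + k \<and> c \<le> Suc v" if "i > b" for i c
    using that by (auto simp: P hA hB ramp_def)
  have AB: "A i c \<le> B i c + 1" "B i c \<le> A i c" if "i \<le> a \<or> b < i" for i c
    using that ab by (auto simp: hA hB ramp_def)
  note fe = heightsD(1)[OF A] heightsD(1)[OF B]
  let ?X = "reach P (0, Suc u)"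
  have p0: "(0, Suc u) \<in> P" using P_bot[of 0 "Suc u"] k by simp
  show ?thesis
  proof (cases "\<exists>(i, c)\<in>?X. i > b")
    \<comment> \<open>The component stays below the sinks: exchanging on \<open>?X\<close> trades
      the sources of \<open>A\<close> and \<open>B\<close> but keeps their sinks, which gives the
      first term of the maximum.\<close>
    case False
    let ?F = "\<lambda>i c. if (i, c) \<in> ?X then B i c else A i c"
    let ?G = "\<lambda>i c. if (i, c) \<in> ?X then A i c else B i c"
    have X: "A i c > B i c \<and> A j d \<le> B j d" if "adj (i, c) (j, d)" "(i, c) \<in> ?X" "(j, d) \<notin> ?X" for i c j d
      using reach_step[OF that(2,1)] that reach_subset[OF p0] P by fastforce
    have bot: "(i, c) \<in> ?X \<longleftrightarrow> (i, c) \<in> P" if "i \<le> a" for i c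
    proof
      assume "(i, c) \<in> P"
      then have c: "u < c" "c \<le> u + k" using P_bot that by auto
      have "(0, c) \<in> ?X" by (rule reach_row[OF reach_refl]) (use c P_bot in auto)
      then show "(i, c) \<in> ?X" by (rule reach_col) (use c P_bot that in auto)
    qed (use reach_subset[OF p0] in blast)
    have low: "?F i c = ramp k (int c - int (Suc u))" "?G i c = ramp k (int c - int u)" if "i \<le> a" for i c
      using bot[OF that, of c] AB(2)[of i c] that hA(1)[OF that, of c] hB(1)[OF that, of c] by (auto simp: P)
    have high: "?F i c = ramp k (int c - int v - 1 + int k)"
      "?G i c = ramp k (int c - int (Suc v) - 1 + int k)" if "i > b" for i c
      using False that hA(2)[OF that, of c] hB(2)[OF that, of c] by auto
    have fe': "feasible ?F" "feasible ?G"
      by (rule feasible_swap[OF fe]; use X in blast)+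
    have "?F \<in> heights a (Suc u) b v k"
      by (rule heightsI[OF fe'(1) low(1) high(1)])
    moreover have "?G \<in> heights a u b (Suc v) k"
      by (rule heightsI[OF fe'(2) low(2) high(2)])
    moreover have "weight a b {u..Suc v} x A + weight a b {u..Suc v} x B =
        weight a b {u..Suc v} x ?F + weight a b {u..Suc v} x ?G" by (rule weight_add) auto
    ultimately show ?thesis
      using hmax_ge'[of ?F a "Suc u" b v k "{u..Suc v}" x] hmax_ge'[of ?G a u b "Suc v" k "{u..Suc v}" x] k
      by fastforce
  next
    case True
    then obtain i1 c1 where ic1: "(i1, c1) \<in> ?X" "i1 > b" by auto
    \<comment> \<open>The component of the left border in the complement of \<open>P\<close>. As
      \<open>P\<close> joins sources to sinks, \<open>?Y\<close> cannot get past it; shifting by one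
      outside \<open>?Y\<close> takes a path from \<open>A\<close> and adds one to \<open>B\<close>,
      which gives the second term.\<close>
    let ?Y = "reach (- P) (0, 0)"
    have q0: "(0, 0) \<in> - P" using left[of 0 0] by (simp add: P)
    have no: "c \<le> Suc v" if "(i, c) \<in> ?Y" for i c
    proof (rule ccontr)
      assume "\<not> ?thesis"
      moreover have "(i1, c1) \<in> P" using ic1(1) reach_subset[OF p0] by blast
      ultimately show False
        using no_double_crossing[OF p0 _ _ _ that ic1(1)] q0 P_cols P_top ic1(2) by fastforce
    qed
    let ?F = "\<lambda>i c. if (i, c) \<in> ?Y then A i c else A i c - 1"
    let ?G = "\<lambda>i c. if (i, c) \<in> ?Y then B i c else B i c + 1"
    have Y: "A i c \<le> B i c \<and> A j d > B j d" if "adj (i, c) (j, d)" "(i, c) \<in> ?Y" "(j, d) \<notin> ?Y" for i c j d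
      using reach_step[OF that(2,1)] that reach_subset[OF q0] P by fastforce
    have row: "(i, c) \<in> ?Y" if "\<And>d. d \<le> c \<Longrightarrow> (i, d) \<notin> P" for i c
    proof -
      have "(i, 0) \<in> ?Y" by (rule reach_col[OF reach_refl]) (use left[of 0] P in auto)
      then show ?thesis by (rule reach_row) (use that in auto)
    qed
    have bot: "(i, c) \<in> ?Y \<longleftrightarrow> c \<le> u" if "i \<le> a" for i c
    proof
      assume Y: "(i, c) \<in> ?Y"
      then have "(i, c) \<notin> P" using reach_subset[OF q0] by blast
      \<comment> \<open>To the right of the source segment row \<open>i\<close> avoids
        \<open>P\<close>, so \<open>?Y\<close> would continue along it beyond column
        \<open>Suc v\<close>.\<close>
      moreover have False if "c > u + k"
      proof -
        have "(i, max c (Suc (Suc v))) \<in> ?Y"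
          by (rule reach_row[OF Y]) (use \<open>i \<le> a\<close> that P_bot in auto)
        then show False using no by fastforce
      qed
      ultimately show "c \<le> u" using P_bot[OF that] by force
    qed (use row P_bot that in auto)
    have top: "(i, c) \<in> ?Y \<longleftrightarrow> c + k \<le> Suc v" if "i > b" for i c
    proof
      assume Y: "(i, c) \<in> ?Y"
      then have "(i, c) \<notin> P" using reach_subset[OF q0] by blast
      then show "c + k \<le> Suc v" using P_top[OF that] no[OF Y] by force
    qed (use row P_top that in auto)
    obtain l where l: "k = Suc l" using k by (cases k) auto
    have low: "?F i c = ramp l (int c - int (Suc u))" "?G i c = ramp (Suc k) (int c - int u)"
      if "i \<le> a" for i c
      using bot[OF that, of c] hA(1)[OF that, of c] hB(1)[OF that, of c]
        ramp_Suc[of "int c - int u" k] ramp_Suc[of "int c - int u" l]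
      by (cases "c \<le> u"; simp add: ramp_nonpos l algebra_simps)+
    have high: "?F i c = ramp l (int c - int v - 1 + int l)"
      "?G i c = ramp (Suc k) (int c - int (Suc v) - 1 + int (Suc k))" if "i > b" for i c
      using top[OF that, of c] hA(2)[OF that, of c] hB(2)[OF that, of c]
        ramp_Suc[of "int c - int v - 1 + int k" k] ramp_Suc[of "int c - int v - 1 + int k" l]
      by (cases "c + k \<le> Suc v"; simp add: ramp_nonpos l algebra_simps)+
    have fe': "feasible ?F" "feasible ?G"
      by (rule feasible_shift[OF fe]; use Y in blast)+
    have "?F \<in> heights a (Suc u) b v (k - 1)"
      using heightsI[OF fe'(1) low(1) high(1)] l by simp
    moreover have "?G \<in> heights a u b (Suc v) (k + 1)"
      using heightsI[OF fe'(2) low(2) high(2)] by (simp only: Suc_eq_plus1)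
    moreover have "weight a b {u..Suc v} x A + weight a b {u..Suc v} x B =
        weight a b {u..Suc v} x ?F + weight a b {u..Suc v} x ?G" by (rule weight_add) auto
    ultimately show ?thesis
      using hmax_ge'[of ?F a "Suc u" b v "k - 1" "{u..Suc v}" x]
        hmax_ge'[of ?G a u b "Suc v" "k + 1" "{u..Suc v}" x] k
      by fastforce
  qed
qed

lemma hmax_octahedron:
  assumes k: "1 \<le> k" "u + k \<le> v" "a + k \<le> b"
  shows "hmax a u b v x k + hmax a (Suc u) b (Suc v) x k =
    max (hmax a (Suc u) b v x k + hmax a u b (Suc v) x k)
        (hmax a (Suc u) b v x (k - 1) + hmax a u b (Suc v) x (k + 1))"
proof (rule antisym)
  let ?w = "weight a b {u..Suc v} x"
  have kb: "k + 1 \<le> Suc b - a" "k - 1 \<le> Suc b - a" using k by auto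
  have att: "\<exists>M\<in>heights a u' b v' k'. ?w M = hmax a u' b v' x k'"
    if "k' \<le> Suc b - a" "u' + k' \<le> Suc v'" "u \<le> u'" "v' \<le> Suc v" for u' v' k'
    using hmax_attained[OF that(1,2), of x] weight_cong_cols[of _ a u' b v' k' "{u..Suc v}" x] that
    by (metis atLeastatMost_subset_iff finite_atLeastAtMost)
  obtain A B where "A \<in> heights a u b v k" "?w A = hmax a u b v x k"
    "B \<in> heights a (Suc u) b (Suc v) k" "?w B = hmax a (Suc u) b (Suc v) x k"
    using att[of k u v] att[of k "Suc u" "Suc v"] k kb by auto
  then show "hmax a u b v x k + hmax a (Suc u) b (Suc v) x k \<le>
    max (hmax a (Suc u) b v x k + hmax a u b (Suc v) x k)
        (hmax a (Suc u) b v x (k - 1) + hmax a u b (Suc v) x (k + 1))"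
    using hmax_octahedron_le[of A a u b v k B x] k by simp
  obtain A B where "A \<in> heights a (Suc u) b v k" "?w A = hmax a (Suc u) b v x k"
    "B \<in> heights a u b (Suc v) k" "?w B = hmax a u b (Suc v) x k"
    using att[of k "Suc u" v] att[of k u "Suc v"] k kb by auto
  then have "hmax a (Suc u) b v x k + hmax a u b (Suc v) x k \<le> hmax a u b v x k + hmax a (Suc u) b (Suc v) x k"
    using hmax_average[of A a "Suc u" b v k B u "Suc v" k u k v x] k by (auto simp: ramp_def)
  moreover obtain A B where "A \<in> heights a (Suc u) b v (k - 1)" "?w A = hmax a (Suc u) b v x (k - 1)"
    "B \<in> heights a u b (Suc v) (k + 1)" "?w B = hmax a u b (Suc v) x (k + 1)"
    using att[of "k - 1" "Suc u" v] att[of "k + 1" u "Suc v"] k kb by auto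
  then have "hmax a (Suc u) b v x (k - 1) + hmax a u b (Suc v) x (k + 1) \<le> hmax a u b v x k + hmax a (Suc u) b (Suc v) x k"
    using hmax_average[of A a "Suc u" b v "k - 1" B u "Suc v" "k + 1" u k v x] k by (auto simp: ramp_def)
  ultimately show "max (hmax a (Suc u) b v x k + hmax a u b (Suc v) x k)
        (hmax a (Suc u) b v x (k - 1) + hmax a u b (Suc v) x (k + 1)) \<le> hmax a u b v x k + hmax a (Suc u) b (Suc v) x k"
    by simp
qed

subsection \<open>Path systems as height functions\<close>

text \<open>The vertex set of a path that enters row \<open>i\<close> in column \<open>e i\<close>
  and leaves it in column \<open>e (Suc i)\<close>. This profile is what height functions
  count.\<close>

definition region :: "nat \<Rightarrow> nat \<Rightarrow> (nat \<Rightarrow> nat) \<Rightarrow> (nat \<times> nat) set" where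
  "region a b e = {(i, c). a \<le> i \<and> i \<le> b \<and> e i \<le> c \<and> c \<le> e (Suc i)}"

lemma lattice_path_region:
  assumes "lattice_path (a, c\<^sub>0) (b, c\<^sub>1) p"
  shows "\<exists>e. a \<le> b \<and> e a = c\<^sub>0 \<and> e (Suc b) = c\<^sub>1 \<and> (\<forall>i. a \<le> i \<and> i \<le> b \<longrightarrow> e i \<le> e (Suc i)) \<and>
    set p = region a b e"
  using assms
proof (induction p arbitrary: a c\<^sub>0)
  case (Cons y p)
  show ?case
  proof (cases "p = []")
    case True
    with Cons.prems show ?thesis
      by (intro exI[of _ "\<lambda>_. c\<^sub>0"]) (auto simp: lattice_path_def region_def)
  next
    case False
    obtain a' d where hd: "hd p = (a', d)" by (metis surj_pair)
    have y: "y = (a, c\<^sub>0)" and st: "lattice_step (a, c\<^sub>0) (a', d)" and p: "lattice_path (a', d) (b, c\<^sub>1) p"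
      using Cons.prems False hd by (auto simp: lattice_path_def successively_Cons)
    obtain e where e: "a' \<le> b" "e a' = d" "e (Suc b) = c\<^sub>1" "\<And>i. a' \<le> i \<Longrightarrow> i \<le> b \<Longrightarrow> e i \<le> e (Suc i)"
      "set p = region a' b e" using Cons.IH[OF p] by auto
    from st consider "a' = Suc a" "d = c\<^sub>0" | "a' = a" "d = Suc c\<^sub>0" by (auto simp: lattice_step_def)
    then show ?thesis
    proof cases
      case 1
      let ?e = "e(a := c\<^sub>0)"
      have "(i, c) \<in> region a b ?e \<longleftrightarrow> (i, c) \<in> insert (a, c\<^sub>0) (region a' b e)" for i c
        using 1 e(1,2) by (cases "i = a") (auto simp: region_def)
      moreover have "?e i \<le> ?e (Suc i)" if "a \<le> i" "i \<le> b" for i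
        using e(4)[of i] 1 e(2) that by (cases "i = a") auto
      ultimately show ?thesis
        using 1 e(1,3,5) y by (intro exI[of _ ?e]) (auto simp del: fun_upd_apply simp: fun_upd_same fun_upd_other)
    next
      case 2
      let ?e = "e(a := c\<^sub>0)"
      have "Suc c\<^sub>0 \<le> e (Suc a)" using e(4)[of a] 2 e(1,2) by simp
      then have "(i, c) \<in> region a b ?e \<longleftrightarrow> (i, c) \<in> insert (a, c\<^sub>0) (region a' b e)" for i c
        using 2 e(1,2) by (cases "i = a") (auto simp: region_def)
      moreover have "?e i \<le> ?e (Suc i)" if "a \<le> i" "i \<le> b" for i
        using e(4)[of i] 2 \<open>Suc c\<^sub>0 \<le> e (Suc a)\<close> that by (cases "i = a") auto
      ultimately show ?thesis
        using 2 e(1,3,5) y by (intro exI[of _ ?e]) (auto simp del: fun_upd_apply simp: fun_upd_same fun_upd_other)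
    qed
  qed
qed (simp add: lattice_path_def)

lemma region_lattice_path:
  assumes "a \<le> b" "\<And>i. a \<le> i \<Longrightarrow> i \<le> b \<Longrightarrow> e i \<le> e (Suc i)"
  shows "\<exists>p. lattice_path (a, e a) (b, e (Suc b)) p \<and> set p = region a b e"
  using assms
proof (induction "b - a + (e (Suc b) - e a)" arbitrary: a e rule: less_induct)
  case less
  have mono: "e i \<le> e (Suc b)" if "a \<le> i" "i \<le> Suc b" for i
    using that(2,1)
  proof (induction rule: inc_induct)
    case (step n)
    then show ?case using less.prems(2)[of n] by simp
  qed simp
  have cons: "lattice_path (a, e a) (b, e (Suc b)) ((a, e a) # p)"
    if "lattice_path (a', d) (b, e (Suc b)) p" "lattice_step (a, e a) (a', d)" for a' d p
    using that by (auto simp: lattice_path_def successively_Cons)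
  consider "e a < e (Suc a)" | "e a = e (Suc a)" "a < b" | "e a = e (Suc a)" "a = b"
    using less.prems by (meson le_less order_refl)
  then show ?case
  proof cases
    case 1
    \<comment> \<open>The first step goes right; the remaining path has the same profile except that
      its start is one column further.\<close>
    let ?e = "e(a := Suc (e a))"
    have "\<exists>p. lattice_path (a, ?e a) (b, ?e (Suc b)) p \<and> set p = region a b ?e"
      using 1 less.prems mono[of "Suc a"] by (intro less.hyps) (auto simp: Suc_le_eq)
    then obtain p where p: "lattice_path (a, Suc (e a)) (b, e (Suc b)) p" "set p = region a b ?e"
      using less.prems(1) by auto
    have "insert (a, e a) (region a b ?e) = region a b e"
      using 1 less.prems(1) by (auto simp: region_def split: if_splits)
    then show ?thesis
      using cons[OF p(1)] p(2) by (intro exI[of _ "(a, e a) # p"]) (auto simp: lattice_step_def)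
  next
    case 2
    have "\<exists>p. lattice_path (Suc a, e (Suc a)) (b, e (Suc b)) p \<and> set p = region (Suc a) b e"
      using 2 less.prems by (intro less.hyps) auto
    then obtain p where p: "lattice_path (Suc a, e a) (b, e (Suc b)) p" "set p = region (Suc a) b e"
      using 2 by auto
    have "insert (a, e a) (region (Suc a) b e) = region a b e"
      using 2 by (auto simp: region_def) (metis le_antisym not_less_eq_eq)+
    then show ?thesis
      using cons[OF p(1)] p(2) by (intro exI[of _ "(a, e a) # p"]) (auto simp: lattice_step_def)
  next
    case 3
    then show ?thesis
      by (intro exI[of _ "[(a, e a)]"]) (auto simp: lattice_path_def region_def)
  qed
qed

lemma weight_eq_sum:
  assumes M: "M \<in> heights a u b v k" "u + k \<le> Suc v"
    and U: "\<And>i c. (i, c) \<in> U \<longleftrightarrow> a \<le> i \<and> i \<le> b \<and> M i (Suc c) - M (Suc i) c = 1"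
  shows "weight a b {u..v} x M = sum x U"
proof -
  have "U \<subseteq> {a..b} \<times> {u..v}"
  proof
    fix p assume "p \<in> U"
    then obtain i c where p: "p = (i, c)" "a \<le> i" "i \<le> b" "M i (Suc c) - M (Suc i) c = 1"
      using U by (metis surj_pair)
    have "u \<le> c" using heights_left[OF M(1) _ M(2), of "Suc c" i] heights_left[OF M(1) _ M(2), of c "Suc i"] p
      by (cases "u \<le> c") auto
    moreover have "c \<le> v" using heights_right[OF M(1) _ M(2), of "Suc c" i] heights_right[OF M(1) _ M(2), of c "Suc i"] p
      by (cases "c \<le> v") auto
    ultimately show "p \<in> {a..b} \<times> {u..v}" using p by simp
  qed
  moreover have "x (i, c) * of_int (M i (Suc c) - M (Suc i) c) = (if (i, c) \<in> U then x (i, c) else 0)"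
    if "i \<in> {a..b}" for i c
    using feasible_step[OF heightsD(1)[OF M(1)], of i c] U[of i c] that by auto
  then have "weight a b {u..v} x M = (\<Sum>(i, c)\<in>{a..b} \<times> {u..v}. if (i, c) \<in> U then x (i, c) else 0)"
    by (simp add: weight_def sum.cartesian_product)
  ultimately show ?thesis
    by (simp add: case_prod_unfold sum.inter_restrict[symmetric] Int_absorb1)
qed

lemma card_ramp: "int (card {t. t < k \<and> int t < z}) = ramp k z"
proof -
  have "{t. t < k \<and> int t < z} = {..<min k (nat z)}" by auto
  then have "card {t. t < k \<and> int t < z} = min k (nat z)" by simp
  then show ?thesis by (cases "0 \<le> z") (simp_all add: ramp_def)
qed

lemma path_system_height:
  assumes P: "path_system a u b v k P" and k: "u + k \<le> Suc v" and "a \<le> b"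
  shows "\<exists>M\<in>heights a u b v k. weight a b {u..v} x M = sum x (\<Union>i<k. set (P i))"
proof -
  have "\<forall>t\<in>{..<k}. \<exists>e. e a = u + t \<and> e (Suc b) = v + 1 + t - k \<and>
      (\<forall>i. a \<le> i \<and> i \<le> b \<longrightarrow> e i \<le> e (Suc i)) \<and> set (P t) = region a b e"
    using P lattice_path_region unfolding path_system_def by (metis lessThan_iff)
  from bchoice[OF this] obtain e where e: "\<And>t. t < k \<Longrightarrow> e t a = u + t"
    "\<And>t. t < k \<Longrightarrow> e t (Suc b) = v + 1 + t - k"
    "\<And>t i. t < k \<Longrightarrow> a \<le> i \<Longrightarrow> i \<le> b \<Longrightarrow> e t i \<le> e t (Suc i)"
    "\<And>t. t < k \<Longrightarrow> set (P t) = region a b (e t)" by auto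
  define E where "E t i = e t (max a (min i (Suc b)))" for t i
  have E_mono: "E t i \<le> E t (Suc i)" if "t < k" for t i
  proof -
    consider "i < a" | "b < i" | "a \<le> i" "i \<le> b" by linarith
    then show ?thesis using e(3)[OF that, of i] \<open>a \<le> b\<close> by cases (simp_all add: E_def)
  qed
  \<comment> \<open>The paths through \<open>(i, c)\<close>. Disjointness leaves at most one, and
    this is the diagonal constraint of \<open>feasible\<close>.\<close>
  define Z where "Z i c = {t. t < k \<and> E t i \<le> c \<and> c \<le> E t (Suc i)}" for i c
  have low: "E t i = u + t" if "t < k" "i \<le> a" for t i
    using e(1)[OF that(1)] that by (simp add: E_def)
  have high: "E t i = v + 1 + t - k" if "t < k" "i > b" for t i
    using e(2)[OF that(1)] that \<open>a \<le> b\<close> by (simp add: E_def)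
  have mid: "E t i = e t i" if "a \<le> i" "i \<le> Suc b" for t i
    using that by (simp add: E_def)
  have uniq: "t = t'" if "t \<in> Z i c" "t' \<in> Z i c" for t t' i c
  proof -
    have t: "t < k" "t' < k" using that by (auto simp: Z_def)
    consider "i < a" | "b < i" | "a \<le> i" "i \<le> b" by linarith
    then show ?thesis
    proof cases
      case 1 then show ?thesis using that t by (auto simp: Z_def low)
    next
      case 2 then show ?thesis using that t k by (auto simp: Z_def high)
    next
      case 3
      then have "(i, c) \<in> set (P t)" "(i, c) \<in> set (P t')"
        using that t by (auto simp: Z_def e(4) region_def mid)
      then show ?thesis using P t unfolding path_system_def by blast
    qed
  qed
  have cardZ: "card (Z i c) = of_bool (Z i c \<noteq> {})" for i c
  proof (cases "Z i c = {}")
    case False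
    then obtain t where "t \<in> Z i c" by blast
    then have "Z i c = {t}" using uniq by blast
    then show ?thesis by simp
  qed simp
  define M where "M i c = int (card {t. t < k \<and> E t i < c})" for i c
  have M_diff: "M i (Suc c) - M (Suc i) c = of_bool (Z i c \<noteq> {})" for i c
  proof -
    have "t \<in> {t. t < k \<and> E t i < Suc c} \<longleftrightarrow> t \<in> {t. t < k \<and> E t (Suc i) < c} \<union> Z i c" for t
      using E_mono[of t i] by (auto simp: Z_def)
    then have eq: "{t. t < k \<and> E t i < Suc c} = {t. t < k \<and> E t (Suc i) < c} \<union> Z i c"
      by (rule set_eqI)
    have "card ({t. t < k \<and> E t (Suc i) < c} \<union> Z i c) = card {t. t < k \<and> E t (Suc i) < c} + card (Z i c)"
      by (rule card_Un_disjoint) (auto simp: Z_def)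
    then show ?thesis by (simp only: M_def eq cardZ of_nat_add of_nat_of_bool add_diff_cancel_left')
  qed
  have M: "M \<in> heights a u b v k"
  proof (rule heightsI)
    show "feasible M" unfolding feasible_def
    proof (intro allI conjI)
      fix i c
      show "M i c \<le> M i (Suc c)" unfolding M_def by (intro of_nat_mono card_mono) auto
      show "M (Suc i) c \<le> M i c" unfolding M_def using E_mono
        by (intro of_nat_mono card_mono) (auto intro: le_less_trans)
      show "M i (Suc c) \<le> M (Suc i) c + 1" using M_diff[of i c] by (cases "Z i c = {}") auto
    qed
  next
    fix i c assume i: "i \<le> a"
    have "{t. t < k \<and> E t i < c} = {t. t < k \<and> int t < int c - int u}" using low[OF _ i] by auto
    then show "M i c = ramp k (int c - int u)" by (simp add: M_def card_ramp)
  next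
    fix i c assume i: "i > b"
    have "{t. t < k \<and> E t i < c} = {t. t < k \<and> int t < int c - int v - 1 + int k}" using high[OF _ i] k by auto
    then show "M i c = ramp k (int c - int v - 1 + int k)" by (simp add: M_def card_ramp)
  qed
  moreover have "weight a b {u..v} x M = sum x (\<Union>i<k. set (P i))"
    by (rule weight_eq_sum[OF M k]) (auto simp: M_diff e(4) region_def Z_def mid)
  ultimately show ?thesis by blast
qed

lemma height_path_system:
  assumes M: "M \<in> heights a u b v k" and k: "u + k \<le> Suc v" and "a \<le> b"
  shows "\<exists>P. path_system a u b v k P \<and> weight a b {u..v} x M = sum x (\<Union>i<k. set (P i))"
proof -
  \<comment> \<open>Paths are level lines: path number \<open>t\<close> enters row \<open>i\<close>
    where the height first exceeds \<open>t\<close>.\<close>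
  define e where "e t i = (LEAST c. int t < M i (Suc c))" for t i
  note mono = feasible_mono[OF heightsD(1)[OF M]]
  have e_iff: "e t i < c \<longleftrightarrow> int t < M i c" if "t < k" for t i c
  proof (cases c)
    case 0
    then show ?thesis using heights_left[OF M _ k, of 0 i] by simp
  next
    case (Suc d)
    have ex: "int t < M i (Suc v)" using heights_right[OF M _ k, of "Suc v" i] that by simp
    have "int t < M i (Suc (e t i))"
      unfolding e_def by (rule LeastI) (rule ex)
    then have "e t i \<le> d \<Longrightarrow> int t < M i (Suc d)"
      using mono(1)[of "Suc (e t i)" "Suc d" i] by simp
    moreover have "int t < M i (Suc d) \<Longrightarrow> e t i \<le> d"
      unfolding e_def by (rule Least_le)
    ultimately show ?thesis using Suc by auto
  qed
  have e_mono: "e t i \<le> e t (Suc i)" if "t < k" for t i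
  proof -
    have "int t < M (Suc i) (Suc (e t (Suc i)))" using e_iff[OF that, of "Suc i" "Suc (e t (Suc i))"] by simp
    then have "int t < M i (Suc (e t (Suc i)))"
      using mono(2)[of i "Suc i" "Suc (e t (Suc i))"] by simp
    then show ?thesis using e_iff[OF that, of i "Suc (e t (Suc i))"] by simp
  qed
  have eqI: "e t i = c" if "t < k" "\<And>d. c < d \<longleftrightarrow> int t < M i d" for t i c
  proof -
    have "e t i < d \<longleftrightarrow> c < d" for d using e_iff[OF that(1)] that(2) by simp
    then show ?thesis by (metis linorder_neqE_nat less_irrefl)
  qed
  have e_low: "e t a = u + t" if "t < k" for t
    using that by (intro eqI) (auto simp: heightsD(2)[OF M] ramp_def)
  have e_high: "e t (Suc b) = v + 1 + t - k" if "t < k" for t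
    using that k by (intro eqI) (auto simp: heightsD(3)[OF M] ramp_def)
  have "\<forall>t. \<exists>p. t < k \<longrightarrow> lattice_path (a, e t a) (b, e t (Suc b)) p \<and> set p = region a b (e t)"
    using region_lattice_path[OF \<open>a \<le> b\<close>] e_mono by meson
  then obtain P where P: "\<And>t. t < k \<Longrightarrow> lattice_path (a, u + t) (b, v + 1 + t - k) (P t)"
    "\<And>t. t < k \<Longrightarrow> set (P t) = region a b (e t)" by (metis e_low e_high)
  \<comment> \<open>The value \<open>M (Suc i) c\<close> is the number of the path through
    \<open>(i, c)\<close>; therefore different paths are disjoint.\<close>
  have reg: "(i, c) \<in> region a b (e t) \<longleftrightarrow>
      a \<le> i \<and> i \<le> b \<and> M i (Suc c) - M (Suc i) c = 1 \<and> M (Suc i) c = int t" if "t < k" for i c t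
  proof -
    have "(i, c) \<in> region a b (e t) \<longleftrightarrow> a \<le> i \<and> i \<le> b \<and> int t < M i (Suc c) \<and> \<not> int t < M (Suc i) c"
      using e_iff[OF that, of i "Suc c"] e_iff[OF that, of "Suc i" c]
      by (auto simp: region_def less_Suc_eq_le not_less)
    also have "\<dots> \<longleftrightarrow> a \<le> i \<and> i \<le> b \<and> M i (Suc c) - M (Suc i) c = 1 \<and> M (Suc i) c = int t"
      using feasible_step[OF heightsD(1)[OF M], of i c] by auto
    finally show ?thesis .
  qed
  have "path_system a u b v k P"
    unfolding path_system_def using P(1) by (auto simp: P(2) reg)
  moreover have "(i, c) \<in> (\<Union>i<k. set (P i)) \<longleftrightarrow> a \<le> i \<and> i \<le> b \<and> M i (Suc c) - M (Suc i) c = 1" for i c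
  proof -
    have "0 \<le> M (Suc i) c" using mono(1)[of 0 c "Suc i"] heights_left[OF M _ k, of 0 "Suc i"] by simp
    moreover have "M i (Suc c) \<le> int k"
      using mono(1)[of "Suc c" "max (Suc c) (Suc v)" i] heights_right[OF M _ k, of "max (Suc c) (Suc v)" i] by simp
    ultimately have "M i (Suc c) - M (Suc i) c = 1 \<Longrightarrow> \<exists>t<k. M (Suc i) c = int t"
      by (intro exI[of _ "nat (M (Suc i) c)"]) auto
    then show ?thesis by (auto simp: P(2) reg)
  qed
  then have "weight a b {u..v} x M = sum x (\<Union>i<k. set (P i))" by (rule weight_eq_sum[OF M k])
  ultimately show ?thesis by blast
qed

lemma path_system_weights:
  assumes "u + k \<le> Suc v" "a \<le> b"
  shows "{\<Sum>p\<in>(\<Union>i<k. set (P i)). x p | P. path_system a u b v k P} =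
    weight a b {u..v} x ` heights a u b v k"
proof (intro equalityI subsetI)
  fix w assume "w \<in> {\<Sum>p\<in>(\<Union>i<k. set (P i)). x p | P. path_system a u b v k P}"
  then obtain P where P: "path_system a u b v k P" "w = sum x (\<Union>i<k. set (P i))" by blast
  then show "w \<in> weight a b {u..v} x ` heights a u b v k"
    using path_system_height[OF P(1) assms, of x] by force
next
  fix w assume "w \<in> weight a b {u..v} x ` heights a u b v k"
  then obtain M where M: "M \<in> heights a u b v k" "w = weight a b {u..v} x M" by blast
  then show "w \<in> {\<Sum>p\<in>(\<Union>i<k. set (P i)). x p | P. path_system a u b v k P}"
    using height_path_system[OF M(1) assms, of x] by blast
qed

lemma H_eq_hmax:
  assumes "a \<le> b" "u \<le> v"
  shows "H a u b v x k = hmax a u b v x (min k (min (Suc b - a) (Suc v - u)))"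
proof -
  define m where "m = min k (min (Suc b - a) (Suc v - u))"
  have "m = min k (min (b - a + 1) (v - u + 1))" and m: "u + m \<le> Suc v" using assms by (auto simp: m_def Suc_diff_le)
  then show ?thesis
    unfolding H_def Let_def hmax_def path_system_weights[OF m assms(1), symmetric] m_def[symmetric]
    by simp
qed

subsection \<open>Symmetries\<close>

lemma hmax_cong:
  assumes "\<And>i c. a \<le> i \<Longrightarrow> i \<le> b \<Longrightarrow> u \<le> c \<Longrightarrow> c \<le> v \<Longrightarrow> x (i, c) = y (i, c)"
  shows "hmax a u b v x k = hmax a u b v y k"
  using assms by (simp add: hmax_def weight_def)

lemma hmax_le_hmax:
  assumes "k \<le> Suc b - a" "u + k \<le> Suc v"
    and "\<And>M. M \<in> heights a u b v k \<Longrightarrow>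
      \<exists>M'\<in>heights a' u' b' v' k'. weight a b {u..v} x M = weight a' b' {u'..v'} x' M'"
  shows "hmax a u b v x k \<le> hmax a' u' b' v' x' k'"
  using hmax_attained[OF assms(1,2), of x] assms(3) hmax_ge by metis

lemma hmax_rotate_le:
  assumes k: "k \<le> Suc b - a" "u + k \<le> Suc v" and w: "v \<le> w" "u \<le> v"
  shows "hmax a u b v x k \<le> hmax a (w - v) b (w - u) (\<lambda>(i, c). x (a + b - i, w - c)) k"
proof (rule hmax_le_hmax[OF k])
  fix M assume M: "M \<in> heights a u b v k"
  \<comment> \<open>A half-turn exchanges the two sides of each path, hence the complement to
    \<open>k\<close>. Corners reflect with offset one more than vertices.\<close>
  let ?M = "\<lambda>i c. int k - M (a + b + 1 - i) (w + 1 - c)"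
  note fe = feasibleD[OF heightsD(1)[OF M]]
  have left: "M i 0 = 0" for i using heights_left[OF M _ k(2)] by simp
  have sym: "int k - ramp k z = ramp k (int k - z)" for z by (auto simp: ramp_def)
  have "?M \<in> heights a (w - v) b (w - u) k"
  proof (rule heightsI)
    show "feasible ?M" unfolding feasible_def
    proof (intro allI conjI)
      fix i c
      define I I' J J' where defs: "I = a + b + 1 - Suc i" "I' = a + b + 1 - i" "J = w + 1 - Suc c" "J' = w + 1 - c"
      \<comment> \<open>Truncated subtraction sends all indices out of range to 0, where
        neighbouring corners coincide.\<close>
      have i: "I' = Suc I \<or> I' = 0 \<and> I = 0" and c: "J' = Suc J \<or> J' = 0 \<and> J = 0" by (auto simp: defs)
      have "M I' J \<le> M I' J'" using c fe by auto
      then show "?M i c \<le> ?M i (Suc c)" by (simp add: defs)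
      have "M I' J' \<le> M I J'" using i fe by auto
      then show "?M (Suc i) c \<le> ?M i c" by (simp add: defs)
      have "M 0 (Suc d) \<le> M 0 d + 1" for d
        using ramp_step[of k "int d - int u"] by (simp add: heightsD(2)[OF M] algebra_simps)
      then have "M I J' \<le> M I' J + 1"
        using i c fe(3)[of I J] by (elim disjE) (auto simp: left)
      then show "?M i (Suc c) \<le> ?M (Suc i) c + 1" by (simp add: defs)
    qed
  next
    fix i c assume "i \<le> a"
    then have "?M i c = ramp k (int k - (int (w + 1 - c) - int v - 1 + int k))"
      using heightsD(3)[OF M, of "a + b + 1 - i" "w + 1 - c"] by (simp add: sym)
    also have "\<dots> = ramp k (int c - int (w - v))"
      using w k by (cases "c \<le> w + 1") (auto simp: of_nat_diff ramp_def)
    finally show "?M i c = ramp k (int c - int (w - v))" .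
  next
    fix i c assume "i > b"
    then have "?M i c = ramp k (int k - (int (w + 1 - c) - int u))"
      using heightsD(2)[OF M, of "a + b + 1 - i" "w + 1 - c"] by (simp add: sym)
    also have "\<dots> = ramp k (int c - int (w - u) - 1 + int k)"
      using w k by (cases "c \<le> w + 1") (auto simp: of_nat_diff ramp_def)
    finally show "?M i c = ramp k (int c - int (w - u) - 1 + int k)" .
  qed
  moreover have "weight a b {u..v} x M = weight a b {w - v..w - u} (\<lambda>(i, c). x (a + b - i, w - c)) ?M"
    unfolding weight_def
  proof (rule sum.reindex_bij_witness[of _ "\<lambda>i. a + b - i" "\<lambda>i. a + b - i"], goal_cases)
    case (5 i)
    show ?case
      by (rule sum.reindex_bij_witness[of _ "\<lambda>c. w - c" "\<lambda>c. w - c"])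
        (use 5 w in \<open>auto simp: Suc_diff_le\<close>)
  qed auto
  ultimately show "\<exists>M'\<in>heights a (w - v) b (w - u) k. weight a b {u..v} x M =
    weight a b {w - v..w - u} (\<lambda>(i, c). x (a + b - i, w - c)) M'" by blast
qed

lemma hmax_rotate:
  assumes k: "k \<le> Suc b - a" "u + k \<le> Suc v" and w: "v \<le> w" "u \<le> v"
  shows "hmax a u b v x k = hmax a (w - v) b (w - u) (\<lambda>(i, c). x (a + b - i, w - c)) k"
proof (rule antisym[OF hmax_rotate_le[OF assms]])
  let ?x = "\<lambda>(i, c). x (a + b - i, w - c)"
  have "hmax a (w - v) b (w - u) ?x k \<le>
      hmax a (w - (w - u)) b (w - (w - v)) (\<lambda>(i, c). ?x (a + b - i, w - c)) k"
    by (rule hmax_rotate_le) (use assms in auto)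
  also have "\<dots> = hmax a u b v x k"
    using w by (subst hmax_cong[of _ _ _ _ _ x]) auto
  finally show "hmax a (w - v) b (w - u) ?x k \<le> hmax a u b v x k" .
qed

text \<open>Reduces membership in \<open>heights\<close> to a table on the corners of the rectangle.
  Clamped neighbours may coincide in one index; the prescribed border values, 0, \<open>k\<close>
  and the two ramps, supply the constraints in that case.\<close>

lemma heights_clampI:
  fixes T :: "nat \<Rightarrow> nat \<Rightarrow> int"
  assumes ab: "a \<le> b" "u \<le> v" and k: "k \<le> Suc b - a" "u + k \<le> Suc v"
    and diag: "\<And>i c. a \<le> i \<Longrightarrow> i \<le> b \<Longrightarrow> u \<le> c \<Longrightarrow> c \<le> v \<Longrightarrow> T i (Suc c) \<le> T (Suc i) c + 1"
    and row: "\<And>i c. a \<le> i \<Longrightarrow> i \<le> Suc b \<Longrightarrow> u \<le> c \<Longrightarrow> c \<le> v \<Longrightarrow> T i c \<le> T i (Suc c)"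
    and col: "\<And>i c. a \<le> i \<Longrightarrow> i \<le> b \<Longrightarrow> u \<le> c \<Longrightarrow> c \<le> Suc v \<Longrightarrow> T (Suc i) c \<le> T i c"
    and left: "\<And>i. a \<le> i \<Longrightarrow> i \<le> Suc b \<Longrightarrow> T i u = 0"
    and right: "\<And>i. a \<le> i \<Longrightarrow> i \<le> Suc b \<Longrightarrow> T i (Suc v) = int k"
    and bottom: "\<And>c. u \<le> c \<Longrightarrow> c \<le> Suc v \<Longrightarrow> T a c = ramp k (int c - int u)"
    and top: "\<And>c. u \<le> c \<Longrightarrow> c \<le> Suc v \<Longrightarrow> T (Suc b) c = ramp k (int c - int v - 1 + int k)"
  shows "(\<lambda>i c. T (max a (min i (Suc b))) (max u (min c (Suc v)))) \<in> heights a u b v k"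
proof (rule heightsI)
  let ?r = "\<lambda>i. max a (min i (Suc b))" and ?s = "\<lambda>c. max u (min c (Suc v))"
  have r: "a \<le> ?r i" "?r i \<le> Suc b" and s: "u \<le> ?s c" "?s c \<le> Suc v" for i c
    using ab by auto
  have r': "?r (Suc i) = ?r i \<and> (?r i = a \<or> ?r i = Suc b) \<or> ?r (Suc i) = Suc (?r i) \<and> ?r i \<le> b" for i
    using ab by (auto simp: max_def min_def)
  have s': "?s (Suc c) = ?s c \<and> (?s c = u \<or> ?s c = Suc v) \<or> ?s (Suc c) = Suc (?s c) \<and> ?s c \<le> v" for c
    using ab by (auto simp: max_def min_def)
  have st: "ramp k (int (Suc c) - z) \<le> ramp k (int c - z) + 1" for c z
    using ramp_step[of k "int c - z"] by (simp add: algebra_simps)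
  have edge: "T i (Suc c) \<le> T i c + 1" if "i = a \<or> i = Suc b" "u \<le> c" "c \<le> v" for i c
    using that st[of c "int u"] st[of c "int v + 1 - int k"] bottom[of c] bottom[of "Suc c"] top[of c] top[of "Suc c"]
    by (auto simp: algebra_simps)
  have side: "T i c = T j c" if "c = u \<or> c = Suc v" "a \<le> i" "i \<le> Suc b" "a \<le> j" "j \<le> Suc b" for i j c
    using that left right by auto
  show "feasible (\<lambda>i c. T (?r i) (?s c))"
    unfolding feasible_def
  proof (intro allI conjI)
    fix i c
    show "T (?r i) (?s c) \<le> T (?r i) (?s (Suc c))"
      using s'[of c] row[OF r, of "?s c"] s by (elim disjE) auto
    show "T (?r (Suc i)) (?s c) \<le> T (?r i) (?s c)"
      using r'[of i] col[OF _ _ s, of "?r i"] r by (elim disjE) auto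
    show "T (?r i) (?s (Suc c)) \<le> T (?r (Suc i)) (?s c) + 1"
      using s'[of c]
    proof
      assume "?s (Suc c) = ?s c \<and> (?s c = u \<or> ?s c = Suc v)"
      then show ?thesis using side[OF _ r r, of "?s c" i "Suc i"] by simp
    next
      assume s1: "?s (Suc c) = Suc (?s c) \<and> ?s c \<le> v"
      show ?thesis using r'[of i]
      proof
        assume "?r (Suc i) = ?r i \<and> (?r i = a \<or> ?r i = Suc b)"
        then show ?thesis using s1 edge[of "?r i" "?s c"] s by simp
      next
        assume "?r (Suc i) = Suc (?r i) \<and> ?r i \<le> b"
        then show ?thesis using s1 diag[of "?r i" "?s c"] s r by simp
      qed
    qed
  qed
next
  fix i c assume "i \<le> a"
  then have "max a (min i (Suc b)) = a" by simp
  moreover have "ramp k (int (max u (min c (Suc v))) - int u) = ramp k (int c - int u)"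
    using k ab by (auto simp: max_def min_def ramp_def)
  ultimately show "T (max a (min i (Suc b))) (max u (min c (Suc v))) = ramp k (int c - int u)"
    using bottom[of "max u (min c (Suc v))"] ab by simp
next
  fix i c assume "b < i"
  then have "max a (min i (Suc b)) = Suc b" using ab by simp
  moreover have "ramp k (int (max u (min c (Suc v))) - int v - 1 + int k) = ramp k (int c - int v - 1 + int k)"
    using k ab by (auto simp: max_def min_def ramp_def)
  ultimately show "T (max a (min i (Suc b))) (max u (min c (Suc v))) = ramp k (int c - int v - 1 + int k)"
    using top[of "max u (min c (Suc v))"] ab by simp
qed

lemma feasible_diag:
  assumes "feasible M" shows "M i (c + n) \<le> M (i + n) c + int n"
proof (induction n arbitrary: c)
  case (Suc n)
  show ?case using Suc.IH[of "Suc c"] feasibleD(3)[OF assms, of "i + n" c] by simp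
qed simp

text \<open>Near the two corners where the paths start and end every vertex is used. Transposing a path
  system exchanges the two ways of filling these triangles, which is what the terms other than
  \<open>- M i c\<close> below account for.\<close>

lemma hmax_transpose_le:
  assumes k: "k \<le> Suc b - a" "u + k \<le> Suc v" and ab: "a \<le> b" "u \<le> v"
  shows "hmax a u b v x k \<le> hmax u a v b (\<lambda>(i, c). x (c, i)) k"
proof (rule hmax_le_hmax[OF k])
  fix M assume M: "M \<in> heights a u b v k"
  \<comment> \<open>A path crossing the antidiagonal just before the corner passes it on exactly one
    side. The first term counts the paths started by then; the second counts those already ended,
    which occur on both sides. Both terms depend only on \<open>i + c\<close>, so \<open>T\<close>
    marks the same vertices as \<open>M\<close>.\<close>
  define T where "T c i = min (int k) (int i - int a + int c - int u)
    + max 0 (int k - (int b + 1 - int i + int v + 1 - int c)) - M i c" for c i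
  note fe = feasibleD[OF heightsD(1)[OF M]] and dg = feasible_diag[OF heightsD(1)[OF M]]
    and mono = feasible_mono[OF heightsD(1)[OF M]]
  have k': "a + k \<le> Suc b" using k ab by simp
  \<comment> \<open>Near the source corner the upper bound from row \<open>a\<close> and the lower
    bound along the antidiagonal coincide; \<open>stop\<close> is the same at the sinks.\<close>
  have start: "M i c = int c - int u" if "a \<le> i" "u \<le> c" "i + c \<le> a + u + k" for i c
  proof (rule antisym)
    have "ramp k (int c - int u) = int c - int u" using that by (auto simp: ramp_def)
    then show "M i c \<le> int c - int u" using mono(2)[of a i c] that by (simp add: heightsD(2)[OF M])
    have "ramp k (int (c + (i - a)) - int u) = int (c + (i - a)) - int u"
      using that by (auto simp: ramp_def of_nat_diff)
    then show "int c - int u \<le> M i c"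
      using dg[of a c "i - a"] that by (simp add: heightsD(2)[OF M])
  qed
  have stop: "M i c = int c - int v - 1 + int k" if "i \<le> Suc b" "c \<le> Suc v" "Suc b + Suc v \<le> i + c + k" for i c
  proof (rule antisym)
    have "ramp k (int c - int v - 1 + int k) = int c - int v - 1 + int k" using that by (auto simp: ramp_def)
    then show "int c - int v - 1 + int k \<le> M i c"
      using mono(2)[of i "Suc b" c] that by (simp add: heightsD(3)[OF M])
    have "Suc b \<le> c + i" using that k by simp
    then have "ramp k (int (c - (Suc b - i)) - int v - 1 + int k) = int c - int (Suc b - i) - int v - 1 + int k"
      using that by (auto simp: ramp_def of_nat_diff)
    then show "M i c \<le> int c - int v - 1 + int k"
      using dg[of i "c - (Suc b - i)" "Suc b - i"] that \<open>Suc b \<le> c + i\<close>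
      by (simp add: heightsD(3)[OF M])
  qed
  let ?T = "\<lambda>c i. T (max u (min c (Suc v))) (max a (min i (Suc b)))"
  have "?T \<in> heights u a v b k"
  proof (rule heights_clampI[OF ab(2,1)])
    show "k \<le> Suc v - u" "a + k \<le> Suc b" using k k' by auto
    show "T c (Suc i) \<le> T (Suc c) i + 1" for i c
      using fe(3)[of i c] by (simp add: T_def algebra_simps)
    show "T c i \<le> T c (Suc i)" for c i
      using fe(2)[of i c] by (auto simp: T_def min_def max_def)
    \<comment> \<open>The correction terms grow only in the two corner triangles, and there
      \<open>start\<close> and \<open>stop\<close> make \<open>M\<close> grow as well.\<close>
    show "T (Suc c) i \<le> T c i" if "u \<le> c" "c \<le> v" "a \<le> i" "i \<le> Suc b" for c i
    proof -
      consider "i + c < a + u + k" | "a + u + k \<le> i + c" "Suc b + Suc v \<le> Suc (i + c + k) - 1"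
        | "a + u + k \<le> i + c" "i + c + k < Suc b + Suc v" by linarith
      then show ?thesis
      proof cases
        case 1
        then have "M i (Suc c) = M i c + 1" using start[of i c] start[of i "Suc c"] that by simp
        then show ?thesis using 1 that k k' by (simp add: T_def)
      next
        case 2
        then have "M i (Suc c) = M i c + 1" using stop[of i c] stop[of i "Suc c"] that by simp
        then show ?thesis using 2 that k k' by (simp add: T_def)
      next
        case 3
        then show ?thesis using fe(1)[of i c] by (simp add: T_def)
      qed
    qed
    show "T c a = 0" if "u \<le> c" "c \<le> Suc v" for c
      using that k k' ab by (simp add: T_def heightsD(2)[OF M] ramp_def)
    show "T c (Suc b) = int k" if "u \<le> c" "c \<le> Suc v" for c
      using that k k' ab by (simp add: T_def heightsD(3)[OF M] ramp_def)
    show "T u i = ramp k (int i - int a)" if "a \<le> i" "i \<le> Suc b" for i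
      using that k k' ab heights_left[OF M _ k(2), of u i] by (simp add: T_def ramp_def)
    show "T (Suc v) i = ramp k (int i - int b - 1 + int k)" if "a \<le> i" "i \<le> Suc b" for i
      using that k k' ab heights_right[OF M _ k(2), of "Suc v" i] by (simp add: T_def ramp_def)
  qed
  moreover have "weight a b {u..v} x M = weight u v {a..b} (\<lambda>(i, c). x (c, i)) ?T"
    unfolding weight_def
    by (subst sum.swap) (auto intro!: sum.cong simp: T_def max_def min_def algebra_simps)
  ultimately show "\<exists>M'\<in>heights u a v b k. weight a b {u..v} x M = weight u v {a..b} (\<lambda>(i, c). x (c, i)) M'"
    by blast
qed

lemma hmax_transpose:
  assumes k: "k \<le> Suc b - a" "u + k \<le> Suc v" and ab: "a \<le> b" "u \<le> v"
  shows "hmax a u b v x k = hmax u a v b (\<lambda>(i, c). x (c, i)) k"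
proof (rule antisym[OF hmax_transpose_le[OF assms]])
  show "hmax u a v b (\<lambda>(i, c). x (c, i)) k \<le> hmax a u b v x k"
    using hmax_transpose_le[of k v u a b "\<lambda>(i, c). x (c, i)"] k ab by auto
qed

section \<open>Extreme numbers of paths\<close>

lemma hmax_all_columns:
  assumes "u + k = Suc v" "k \<le> Suc b - a"
  shows "hmax a u b v x k = (\<Sum>i\<in>{a..b}. \<Sum>c\<in>{u..v}. x (i, c))"
proof -
  obtain M where M: "M \<in> heights a u b v k" "weight a b {u..v} x M = hmax a u b v x k"
    using hmax_attained[of k b a u v x] assms by auto
  have "M i c = ramp k (int c - int u)" for i c
  proof -
    have "M (max i (Suc b)) c \<le> M i c" "M i c \<le> M (min i a) c"
      by (auto intro!: feasible_mono heightsD(1)[OF M(1)])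
    moreover have "int c - int v - 1 + int k = int c - int u" using assms(1) by simp
    ultimately show ?thesis by (simp add: heightsD(2,3)[OF M(1)])
  qed
  then have "weight a b {u..v} x M = (\<Sum>i\<in>{a..b}. \<Sum>c\<in>{u..v}. x (i, c))"
    unfolding weight_def using assms by (intro sum.cong refl) (auto simp: ramp_def)
  then show ?thesis using M(2) by simp
qed

lemma hmax_0: "u \<le> Suc v \<Longrightarrow> hmax a u b v x 0 = 0"
proof -
  assume u: "u \<le> Suc v"
  obtain M where M: "M \<in> heights a u b v 0" "weight a b {u..v} x M = hmax a u b v x 0"
    using hmax_attained[of 0 b a u v x] u by auto
  have "M i c = 0" for i c
    using feasible_mono(1)[OF heightsD(1)[OF M(1)], of 0 c i]
      feasible_mono(1)[OF heightsD(1)[OF M(1)], of c "max c (Suc v)" i]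
      heights_left[OF M(1), of 0 i] heights_right[OF M(1), of "max c (Suc v)" i] u by simp
  then show ?thesis using M(2) by (simp add: weight_def)
qed

text \<open>With as many paths as columns the source and sink ramps agree, so the system is forced
  and fills the rectangle. Transposition treats the case of as many paths as rows; empty rectangles
  are included for use at the border of recursions.\<close>

lemma hmax_total:
  assumes "u \<le> Suc v" "a \<le> Suc b" "k = min (Suc b - a) (Suc v - u)"
  shows "hmax a u b v x k = (\<Sum>i\<in>{a..b}. \<Sum>c\<in>{u..v}. x (i, c))"
proof -
  consider "u + k = Suc v" | "a + k = Suc b" "a \<le> b" "u \<le> v" | "k = 0" "u = Suc v \<or> a = Suc b"
    using assms by (cases "a \<le> b"; cases "u \<le> v") (auto simp: min_def split: if_splits)
  then show ?thesis
  proof cases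
    case 1 then show ?thesis using hmax_all_columns[of u k v b a x] assms by simp
  next
    case 2
    then have "hmax a u b v x k = hmax u a v b (\<lambda>(i, c). x (c, i)) k"
      using assms by (intro hmax_transpose) auto
    also have "\<dots> = (\<Sum>i\<in>{u..v}. \<Sum>c\<in>{a..b}. x (c, i))"
      using hmax_all_columns[of a k b v u] 2 assms by simp
    finally show ?thesis by (simp add: sum.swap[of _ "{u..v}"])
  next
    case 3 then show ?thesis using hmax_0[OF assms(1)] by auto
  qed
qed

subsection \<open>Corners and intervals\<close>

definition pad_column :: "real \<Rightarrow> nat \<Rightarrow> labelling \<Rightarrow> labelling" where
  "pad_column w n x = (\<lambda>(i, c). if c = 0 then if i = n then w else 0 else x (i, c))"

lemma weight_pad_column:
  "weight 1 (Suc b) {0..j} (pad_column w (Suc b) x) M =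
    weight 1 b {1..j} x M + w * of_int (M (Suc b) 1 - M (Suc (Suc b)) 0) +
    (\<Sum>c\<in>{1..j}. x (Suc b, c) * of_int (M (Suc b) (Suc c) - M (Suc (Suc b)) c))"
proof -
  let ?d = "\<lambda>i c. real_of_int (M i (Suc c) - M (Suc i) c)"
  let ?y = "pad_column w (Suc b) x"
  have "weight 1 (Suc b) {0..j} ?y M = (\<Sum>i\<in>{1..Suc b}. ?y (i, 0) * ?d i 0 + (\<Sum>c\<in>{1..j}. x (i, c) * ?d i c))"
    unfolding weight_def
  proof (rule sum.cong[OF refl])
    fix i
    have "(\<Sum>c\<in>{1..j}. ?y (i, c) * ?d i c) = (\<Sum>c\<in>{1..j}. x (i, c) * ?d i c)"
      by (rule sum.cong) (auto simp: pad_column_def)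
    then show "(\<Sum>c\<in>{0..j}. ?y (i, c) * ?d i c) = ?y (i, 0) * ?d i 0 + (\<Sum>c\<in>{1..j}. x (i, c) * ?d i c)"
      by (simp add: sum.atLeast_Suc_atMost[of 0] One_nat_def)
  qed
  also have "\<dots> = (\<Sum>i\<in>{1..Suc b}. ?y (i, 0) * ?d i 0) + weight 1 b {1..j} x M + (\<Sum>c\<in>{1..j}. x (Suc b, c) * ?d (Suc b) c)"
    by (simp only: sum.distrib weight_def) simp
  also have "(\<Sum>i\<in>{1..Suc b}. ?y (i, 0) * ?d i 0) = ?y (Suc b, 0) * ?d (Suc b) 0"
    by (subst sum.nat_ivl_Suc') (auto intro!: sum.neutral simp: pad_column_def)
  finally show ?thesis by (simp add: pad_column_def One_nat_def)
qed

text \<open>Add a path that climbs column 0 and then follows row \<open>Suc b\<close>, and let each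
  old path step up from its sink. The new sinks are then as required, and row \<open>Suc b\<close>
  is covered completely.\<close>

lemma hmax_pad_column_ge:
  assumes k: "k \<le> b" "k \<le> j"
  shows "w + (\<Sum>c\<in>{1..j}. x (Suc b, c)) + hmax 1 1 b j x k
    \<le> hmax 1 0 (Suc b) j (pad_column w (Suc b) x) (Suc k)"
proof -
  obtain G where G: "G \<in> heights 1 1 b j k" "weight 1 b {1..j} x G = hmax 1 1 b j x k"
    using hmax_attained[of k b 1 1 j x] k by auto
  note fe = feasibleD[OF heightsD(1)[OF G(1)]]
  have left: "G i (Suc 0) = 0" "G i 0 = 0" for i using heights_left[OF G(1)] k by auto
  have pos: "0 \<le> G i c" for i c
    using feasible_mono(1)[OF heightsD(1)[OF G(1)], of 0 c i] left by simp
  define T where "T c = ramp (Suc k) (int c - int j + int k)" for c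
  have T0: "T 0 = 0" "0 \<le> T c" for c using k by (auto simp: T_def ramp_def)
  have T_mono: "T c \<le> T (Suc c)" and T_step: "T (Suc c) \<le> T c + 1" for c
    using ramp_mono[of "int c - int j + int k" "int (Suc c) - int j + int k" "Suc k"]
      ramp_step[of "Suc k" "int c - int j + int k"] by (simp_all add: T_def algebra_simps)
  have G_top: "1 + G (Suc b) c = max 1 (T c)" "1 + G (Suc b) (Suc c) \<le> T c + 1" for c
    by (auto simp: T_def heightsD(3)[OF G(1)] ramp_def)
  define M where "M i c = (if c = 0 then 0 else if i \<le> Suc b then 1 + G i c else T c)" for i c
  have "M \<in> heights 1 0 (Suc b) j (Suc k)"
  proof (rule heightsI)
    show "feasible M" unfolding feasible_def
    proof (intro allI conjI)
      fix i c
      show "M i c \<le> M i (Suc c)" using fe(1)[of i c] pos[of i] T0(2)[of "Suc c"] T_mono[of c]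
        by (auto simp: M_def add_increasing)
      show "M (Suc i) c \<le> M i c" using fe(2)[of i c] G_top(1)[of c]
        by (cases "i = Suc b") (auto simp: M_def)
      have "c = 0 \<Longrightarrow> T (Suc c) \<le> 1" using T_step[of 0] T0 by simp
      then show "M i (Suc c) \<le> M (Suc i) c + 1"
        using fe(3)[of i c] G_top(2)[of c] T_step[of c] left T0
        by (cases "i = Suc b"; cases "i \<le> b") (auto simp: M_def)
    qed
  next
    fix i c :: nat assume "i \<le> 1"
    then show "M i c = ramp (Suc k) (int c - int 0)"
      using heightsD(2)[OF G(1), of i c] ramp_Suc[of "int c" k] by (cases c) (auto simp: M_def ramp_nonpos)
  next
    fix i c assume "i > Suc b"
    then show "M i c = ramp (Suc k) (int c - int j - 1 + int (Suc k))"
      using T0 by (cases c) (auto simp: M_def T_def algebra_simps)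
  qed
  moreover have "weight 1 b {1..j} x M = weight 1 b {1..j} x G"
    unfolding weight_def by (intro sum.cong refl) (auto simp: M_def)
  moreover have "M (Suc b) (Suc c) - M (Suc (Suc b)) c = 1" if "c \<le> j" for c
    using that k by (auto simp: M_def T_def heightsD(3)[OF G(1)] ramp_def)
  ultimately show ?thesis
    using hmax_ge[of M 1 0 "Suc b" j "Suc k" "pad_column w (Suc b) x"] G(2)
    by (simp add: weight_pad_column[unfolded One_nat_def] del: of_int_diff)
qed

lemma weight_le_sum_abs:
  fixes x :: labelling
  assumes "feasible M"
  shows "(\<Sum>c\<in>C. x (i, c) * of_int (M i (Suc c) - M (Suc i) c)) \<le> (\<Sum>c\<in>C. \<bar>x (i, c)\<bar>)"
proof (rule sum_mono)
  fix c
  show "x (i, c) * of_int (M i (Suc c) - M (Suc i) c) \<le> \<bar>x (i, c)\<bar>"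
    using feasible_step[OF assms, of i c] by (auto simp del: of_int_diff)
qed

text \<open>An optimal system either misses the heavy vertex, and then weighs at most the sum of
  absolute labels, or uses it. In the latter case its first path fills column 0 and row
  \<open>Suc b\<close> is covered, so peeling off that path leaves a system for the smaller
  rectangle.\<close>

lemma hmax_pad_column_le:
  assumes k: "k \<le> b" "k \<le> j"
  shows "hmax 1 0 (Suc b) j (pad_column w (Suc b) x) (Suc k)
    \<le> max (w + (\<Sum>c\<in>{1..j}. x (Suc b, c)) + hmax 1 1 b j x k)
        (\<Sum>i\<in>{1..Suc b}. \<Sum>c\<in>{1..j}. \<bar>x (i, c)\<bar>)"
proof -
  obtain M where M: "M \<in> heights 1 0 (Suc b) j (Suc k)"
    "weight 1 (Suc b) {0..j} (pad_column w (Suc b) x) M = hmax 1 0 (Suc b) j (pad_column w (Suc b) x) (Suc k)"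
    using hmax_attained[of "Suc k" "Suc b" 1 0 j "pad_column w (Suc b) x"] k by auto
  note fe = feasibleD[OF heightsD(1)[OF M(1)]]
    and mono = feasible_mono[OF heightsD(1)[OF M(1)]]
  have left: "M i 0 = 0" for i using heights_left[OF M(1)] k by auto
  consider "M (Suc b) 1 = 0" | "M (Suc b) 1 = 1"
    using feasible_step[OF heightsD(1)[OF M(1)], of "Suc b" 0] left by auto
  then show ?thesis
  proof cases
    case 1
    have "weight 1 b {1..j} x M \<le> (\<Sum>i\<in>{1..b}. \<Sum>c\<in>{1..j}. \<bar>x (i, c)\<bar>)"
      unfolding weight_def by (intro sum_mono weight_le_sum_abs heightsD(1)[OF M(1)])
    then have "hmax 1 0 (Suc b) j (pad_column w (Suc b) x) (Suc k) \<le> (\<Sum>i\<in>{1..Suc b}. \<Sum>c\<in>{1..j}. \<bar>x (i, c)\<bar>)"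
      using M(2) 1 weight_le_sum_abs[OF heightsD(1)[OF M(1)], of x "Suc b" "{1..j}"]
      by (simp add: weight_pad_column[unfolded One_nat_def] left del: of_int_diff)
    then show ?thesis by simp
  next
    case 2
    have one: "M i (Suc 0) = 1" if "i \<le> Suc b" for i
      using mono(2)[OF that, of "Suc 0"] 2 mono(2)[of 0 i "Suc 0"] heightsD(2)[OF M(1), of 0 1]
      by (simp add: ramp_def)
    have pos: "1 \<le> M i (Suc c)" if "i \<le> Suc b" for i c
      using mono(1)[of 1 "Suc c" i] one[OF that] by simp
    define T where "T c = ramp k (int c - int j - 1 + int k)" for c
    have top: "M (Suc b) (Suc c) = 1 + T (Suc c)" for c
    proof (rule antisym)
      have "M (Suc b) (Suc c) \<le> 1 + ramp (Suc k) (int c - int j + int k)"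
        using fe(3)[of "Suc b" c] by (simp add: heightsD(3)[OF M(1)] algebra_simps)
      moreover have "M (Suc b) (Suc c) \<le> 1 + int k"
        using mono(2)[of 0 "Suc b" "Suc c"] heightsD(2)[OF M(1), of 0 "Suc c"] by (simp add: ramp_def)
      ultimately show "M (Suc b) (Suc c) \<le> 1 + T (Suc c)" by (auto simp: T_def ramp_def)
      have "ramp (Suc k) (int (Suc c) - int j + int k) \<le> M (Suc b) (Suc c)"
        using fe(2)[of "Suc b" "Suc c"] by (simp add: heightsD(3)[OF M(1)] algebra_simps)
      then show "1 + T (Suc c) \<le> M (Suc b) (Suc c)"
        using pos[of "Suc b" c] by (auto simp: T_def ramp_def)
    qed
    have T0: "T 0 = 0" "T (Suc 0) = 0" using k by (auto simp: T_def ramp_def)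
    have T_mono: "T c \<le> T (Suc c)" and T_step: "T (Suc c) \<le> T c + 1" for c
      using ramp_mono[of "int c - int j - 1 + int k" "int (Suc c) - int j - 1 + int k" k]
        ramp_step[of k "int c - int j - 1 + int k"] by (simp_all add: T_def algebra_simps)
    define G where "G i c = (if c = 0 then 0 else if i \<le> Suc b then M i c - 1 else T c)" for i c
    have "G \<in> heights 1 1 b j k"
    proof (rule heightsI)
      show "feasible G" unfolding feasible_def
      proof (intro allI conjI)
        fix i c
        show "G i c \<le> G i (Suc c)" using fe(1)[of i c] pos[of i c] T_mono[of c] T0
          by (cases c) (auto simp: G_def)
        show "G (Suc i) c \<le> G i c" using fe(2)[of i c] top
          by (cases "i = Suc b"; cases c) (auto simp: G_def)
        show "G i (Suc c) \<le> G (Suc i) c + 1"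
          using fe(3)[of i c] top[of c] T_step[of c] one[of i] T0
          by (cases "i = Suc b"; cases "i \<le> b"; cases c) (auto simp: G_def)
      qed
    next
      fix i c :: nat assume "i \<le> 1"
      then show "G i c = ramp k (int c - int 1)"
        using heightsD(2)[OF M(1), of i c] ramp_Suc[of "int c" k] by (cases c) (auto simp: G_def ramp_nonpos)
    next
      fix i c assume i: "i > b"
      show "G i c = ramp k (int c - int j - 1 + int k)"
        using i T0 top by (cases "i = Suc b"; cases c) (auto simp: G_def T_def)
    qed
    then have "weight 1 b {1..j} x G \<le> hmax 1 1 b j x k" by (rule hmax_ge)
    moreover have "weight 1 b {1..j} x M = weight 1 b {1..j} x G"
      unfolding weight_def by (intro sum.cong refl) (auto simp: G_def)
    moreover have "M (Suc b) (Suc c) - M (Suc (Suc b)) c = 1" if "c \<le> j" for c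
      using that k by (auto simp: top T_def heightsD(3)[OF M(1)] ramp_def)
    ultimately show ?thesis
      using M(2) 2 by (simp add: weight_pad_column[unfolded One_nat_def] left del: of_int_diff)
  qed
qed

lemma hmax_pad_column:
  assumes "k \<le> b" "k \<le> j"
    and "(\<Sum>i\<in>{1..Suc b}. \<Sum>c\<in>{1..j}. \<bar>x (i, c)\<bar>) \<le> w + (\<Sum>c\<in>{1..j}. x (Suc b, c)) + hmax 1 1 b j x k"
  shows "hmax 1 0 (Suc b) j (pad_column w (Suc b) x) (Suc k) =
    w + (\<Sum>c\<in>{1..j}. x (Suc b, c)) + hmax 1 1 b j x k"
  using hmax_pad_column_ge[OF assms(1,2), of w x] hmax_pad_column_le[OF assms(1,2), of w x] assms(3) by simp

declare One_nat_def [simp del]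

text \<open>A heavy label \<open>w\<close> forces the first path to run up an additional column \<open>0\<close> and then along
  the last row; in this way the relation for intervals of columns implies one for corners.\<close>

lemma hmax_corner:
  assumes l: "l < b" "l < d"
  shows "hmax 1 1 (Suc b) (Suc d) x (Suc l) + hmax 1 1 b d x l = x (Suc b, Suc d) +
    max (hmax 1 1 b (Suc d) x (Suc l) + hmax 1 1 (Suc b) d x l)
        (hmax 1 1 b (Suc d) x l + hmax 1 1 (Suc b) d x (Suc l))"
proof -
  define w\<^sub>0 where "w\<^sub>0 j k = (\<Sum>i\<in>{1..Suc b}. \<Sum>c\<in>{1..j}. \<bar>x (i, c)\<bar>)
    - (\<Sum>c\<in>{1..j}. x (Suc b, c)) - hmax 1 1 b j x k" for j k
  \<comment> \<open>Large enough for the three padded values that occur in the octahedron relation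
    at \<open>u = 0\<close>. Afterwards \<open>w\<close> appears once on either side and
    cancels.\<close>
  define w where "w = max (w\<^sub>0 d l) (max (w\<^sub>0 (Suc d) l) (w\<^sub>0 (Suc d) (Suc l)))"
  let ?y = "pad_column w (Suc b) x"
  have col: "hmax 1 0 (Suc b) j ?y (Suc k) = w + (\<Sum>c\<in>{1..j}. x (Suc b, c)) + hmax 1 1 b j x k"
    if "w\<^sub>0 j k \<le> w" "k \<le> b" "k \<le> j" for j k
    by (rule hmax_pad_column) (use that in \<open>auto simp: w\<^sub>0_def\<close>)
  have y: "hmax 1 1 (Suc b) j ?y k = hmax 1 1 (Suc b) j x k" for j k
    by (rule hmax_cong) (simp add: pad_column_def)
  have "w\<^sub>0 d l \<le> w" "w\<^sub>0 (Suc d) l \<le> w" "w\<^sub>0 (Suc d) (Suc l) \<le> w" by (auto simp: w_def)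
  then have "hmax 1 0 (Suc b) d ?y (Suc l) = w + (\<Sum>c\<in>{1..d}. x (Suc b, c)) + hmax 1 1 b d x l"
    "hmax 1 0 (Suc b) (Suc d) ?y (Suc l) = w + (\<Sum>c\<in>{1..Suc d}. x (Suc b, c)) + hmax 1 1 b (Suc d) x l"
    "hmax 1 0 (Suc b) (Suc d) ?y (Suc (Suc l)) = w + (\<Sum>c\<in>{1..Suc d}. x (Suc b, c)) + hmax 1 1 b (Suc d) x (Suc l)"
    using l by (intro col; simp)+
  moreover have "(\<Sum>c\<in>{1..Suc d}. x (Suc b, c)) = (\<Sum>c\<in>{1..d}. x (Suc b, c)) + x (Suc b, Suc d)" by simp
  moreover have "hmax 1 0 (Suc b) d ?y (Suc l) + hmax 1 1 (Suc b) (Suc d) x (Suc l) =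
    max (hmax 1 1 (Suc b) d x (Suc l) + hmax 1 0 (Suc b) (Suc d) ?y (Suc l))
        (hmax 1 1 (Suc b) d x l + hmax 1 0 (Suc b) (Suc d) ?y (Suc (Suc l)))"
    using hmax_octahedron[of "Suc l" 0 d 1 "Suc b" ?y, folded Suc_eq_plus1] l
    by (simp add: y[unfolded One_nat_def] One_nat_def)
  moreover have "max (p + (w + y + q)) (p' + (w + y + q')) = w + y + max (q' + p') (q + p)" for p p' q q' y
    by (simp add: max_def)
  ultimately show ?thesis by (simp add: algebra_simps)
qed

section \<open>Parts of shapes and their local relations\<close>

definition part :: "nat \<Rightarrow> nat \<Rightarrow> nat \<Rightarrow> nat \<Rightarrow> labelling \<Rightarrow> nat \<Rightarrow> real" where
  "part a u b v x t = hmax a u b v x t - hmax a u b v x (t - 1)"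

text \<open>A maximum over those of two neighbours that exist, with value 0 if neither does, as for
  \<open>max_below\<close>.\<close>

definition max_part :: "bool \<Rightarrow> real \<Rightarrow> bool \<Rightarrow> real \<Rightarrow> real" where
  "max_part p y q z = (if p \<and> q then max y z else if p then y else if q then z else 0)"

text \<open>Taking \<open>t - 1\<close> paths in the short interval and \<open>t\<close> in the long
  one out of the octahedron maximum leaves a maximum of two parts. For the largest \<open>t\<close>
  the total sums give the same identity, the flags dropping the parts that do not exist.\<close>

lemma hmax_interval:
  assumes t: "1 \<le> t" "t \<le> Suc b - a" "t \<le> Suc v - u" and ab: "a \<le> b" "u \<le> v"
  shows "hmax a (Suc u) b (Suc v) x t + hmax a u b v x t =
    hmax a (Suc u) b v x (t - 1) + hmax a u b (Suc v) x t +
    max_part (t < Suc v - u) (part a (Suc u) b v x t) (t < Suc b - a) (part a u b (Suc v) x (Suc t))"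
proof (cases "t < Suc v - u \<and> t < Suc b - a")
  case True
  then have "u + t \<le> v" "a + t \<le> b" by auto
  from hmax_octahedron[OF t(1) this, folded Suc_eq_plus1, of x] True show ?thesis
    by (auto simp: part_def max_part_def max_def split: if_splits)
next
  case False
  have cols: "(\<Sum>i\<in>{a..b}. \<Sum>c\<in>{u..Suc w}. x (i, c)) =
      (\<Sum>i\<in>{a..b}. \<Sum>c\<in>{u..w}. x (i, c)) + (\<Sum>i\<in>{a..b}. x (i, Suc w))" if "u \<le> Suc w" for u w
    using that by (simp add: sum.distrib)
  have "hmax a (Suc u) b (Suc v) x t + hmax a u b v x t =
      (\<Sum>i\<in>{a..b}. \<Sum>c\<in>{Suc u..v}. x (i, c)) + (\<Sum>i\<in>{a..b}. \<Sum>c\<in>{u..Suc v}. x (i, c))"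
    using hmax_total[of "Suc u" "Suc v" a b t x] hmax_total[of u v a b t x] False t ab
      cols[of u v] cols[of "Suc u" v] by auto
  moreover have "t = Suc v - u \<Longrightarrow> (\<Sum>i\<in>{a..b}. \<Sum>c\<in>{Suc u..v}. x (i, c)) = hmax a (Suc u) b v x (t - 1)"
    using hmax_total[of "Suc u" v a b "t - 1" x] t ab by auto
  moreover have "t < Suc v - u \<Longrightarrow> t = Suc b - a \<Longrightarrow>
      (\<Sum>i\<in>{a..b}. \<Sum>c\<in>{Suc u..v}. x (i, c)) = hmax a (Suc u) b v x t"
    using hmax_total[of "Suc u" v a b t x] t ab by auto
  moreover have "t = Suc b - a \<Longrightarrow> (\<Sum>i\<in>{a..b}. \<Sum>c\<in>{u..Suc v}. x (i, c)) = hmax a u b (Suc v) x t"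
    using hmax_total[of u "Suc v" a b t x] t ab by auto
  moreover have "t = Suc v - u \<Longrightarrow> t < Suc b - a \<Longrightarrow>
      (\<Sum>i\<in>{a..b}. \<Sum>c\<in>{u..Suc v}. x (i, c)) = hmax a u b (Suc v) x (Suc t)"
    using hmax_total[of u "Suc v" a b "Suc t" x] t ab by (auto simp: Suc_diff_le)
  ultimately show ?thesis using False t by (auto simp: max_part_def part_def)
qed

text \<open>Subtract \<open>hmax_interval\<close> at \<open>t - 1\<close> from the one at
  \<open>t\<close>: two numbers minus their maximum leave their minimum. The result is a toggle,
  with the two intermediate intervals as neighbouring files.\<close>

lemma part_interval:
  assumes t: "1 \<le> t" "t \<le> Suc b - a" "t \<le> Suc v - u" and ab: "a \<le> b" "u \<le> v"
  shows "part a (Suc u) b (Suc v) x t + part a u b v x t =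
    (if t = 1 then part a u b (Suc v) x t else min (part a (Suc u) b v x (t - 1)) (part a u b (Suc v) x t)) +
    max_part (t < Suc v - u) (part a (Suc u) b v x t) (t < Suc b - a) (part a u b (Suc v) x (Suc t))"
proof (cases "t = 1")
  case True
  then show ?thesis
    using hmax_interval[OF assms, of x] ab hmax_0 by (simp add: part_def)
next
  case False
  then obtain l where l: "t = Suc l" "1 \<le> l" using t by (cases t) auto
  then have "l \<le> Suc b - a" "l \<le> Suc v - u" using t by auto
  from hmax_interval[OF l(2) this ab, of x] hmax_interval[OF assms, of x] False t show ?thesis
    by (simp add: l part_def max_part_def[of "l < _"] min_def max_def split: if_splits)
qed

lemma hmax_corner_part:
  assumes l: "l \<le> b" "l \<le> d"
  shows "hmax 1 1 (Suc b) (Suc d) x (Suc l) + hmax 1 1 b d x l = x (Suc b, Suc d) +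
    hmax 1 1 b (Suc d) x l + hmax 1 1 (Suc b) d x l +
    max_part (l < b) (part 1 1 b (Suc d) x (Suc l)) (l < d) (part 1 1 (Suc b) d x (Suc l))"
proof (cases "l < b \<and> l < d")
  case True
  then show ?thesis using hmax_corner[of l b d x] by (auto simp: part_def max_part_def max_def split: if_splits)
next
  case False
  have "(\<Sum>i\<in>{1..Suc b}. \<Sum>c\<in>{1..Suc d}. x (i, c)) + (\<Sum>i\<in>{1..b}. \<Sum>c\<in>{1..d}. x (i, c)) =
    x (Suc b, Suc d) + (\<Sum>i\<in>{1..b}. \<Sum>c\<in>{1..Suc d}. x (i, c)) + (\<Sum>i\<in>{1..Suc b}. \<Sum>c\<in>{1..d}. x (i, c))"
    by (simp add: sum.distrib)
  then have "hmax 1 1 (Suc b) (Suc d) x (Suc l) + hmax 1 1 b d x l =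
    x (Suc b, Suc d) + (\<Sum>i\<in>{1..b}. \<Sum>c\<in>{1..Suc d}. x (i, c)) + (\<Sum>i\<in>{1..Suc b}. \<Sum>c\<in>{1..d}. x (i, c))"
    using hmax_total[of 1 "Suc d" 1 "Suc b" "Suc l" x] hmax_total[of 1 d 1 b l x] False l by auto
  moreover have "l = b \<Longrightarrow> (\<Sum>i\<in>{1..b}. \<Sum>c\<in>{1..Suc d}. x (i, c)) = hmax 1 1 b (Suc d) x l"
    using hmax_total[of 1 "Suc d" 1 b l x] l by auto
  moreover have "l = d \<Longrightarrow> l < b \<Longrightarrow> (\<Sum>i\<in>{1..b}. \<Sum>c\<in>{1..Suc d}. x (i, c)) = hmax 1 1 b (Suc d) x (Suc l)"
    using hmax_total[of 1 "Suc d" 1 b "Suc l" x] l by auto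
  moreover have "l = d \<Longrightarrow> (\<Sum>i\<in>{1..Suc b}. \<Sum>c\<in>{1..d}. x (i, c)) = hmax 1 1 (Suc b) d x l"
    using hmax_total[of 1 d 1 "Suc b" l x] l by auto
  moreover have "l = b \<Longrightarrow> l < d \<Longrightarrow> (\<Sum>i\<in>{1..Suc b}. \<Sum>c\<in>{1..d}. x (i, c)) = hmax 1 1 (Suc b) d x (Suc l)"
    using hmax_total[of 1 d 1 "Suc b" "Suc l" x] l by auto
  ultimately show ?thesis using False l by (auto simp: max_part_def part_def)
qed

text \<open>The recursion that inverts the transfer map: the first parts of the initial rectangles
  form the preimage of the labelling.\<close>

lemma part_corner_1:
  "part 1 1 (Suc b) (Suc d) x 1 = x (Suc b, Suc d) +
    max_part (0 < b) (part 1 1 b (Suc d) x 1) (0 < d) (part 1 1 (Suc b) d x 1)"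
  using hmax_corner_part[of 0 b d x] by (simp add: part_def hmax_0 One_nat_def)

text \<open>Again a difference of two consecutive relations. The label cancels, which is why the
  later parts are produced by toggles alone.\<close>

lemma part_corner_Suc:
  assumes l: "1 \<le> l" "l \<le> b" "l \<le> d"
  shows "part 1 1 (Suc b) (Suc d) x (Suc l) + part 1 1 b d x l =
    min (part 1 1 b (Suc d) x l) (part 1 1 (Suc b) d x l) +
    max_part (l < b) (part 1 1 b (Suc d) x (Suc l)) (l < d) (part 1 1 (Suc b) d x (Suc l))"
proof -
  obtain m where m: "l = Suc m" using l by (cases l) auto
  show ?thesis
    using hmax_corner_part[of l b d x] hmax_corner_part[of m b d x] l
    by (simp add: m part_def max_part_def[of "m < _"] min_def max_def split: if_splits)
qed

text \<open>In \<open>hmax_interval\<close> the term for \<open>Suc u..Suc v\<close> has the largest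
  sum of end points, so solving for it gives a recursion on that sum which stops at intervals
  starting in column 1 or at \<open>k = 0\<close>.\<close>

lemma hmax_determined:
  assumes init: "\<And>v k. v \<le> s \<Longrightarrow> k \<le> Suc b - a \<Longrightarrow> k \<le> v \<Longrightarrow> hmax a 1 b v x k = hmax a 1 b v y k"
    and ab: "a \<le> b" and "1 \<le> u" "u \<le> Suc v" "v \<le> s" "k \<le> Suc b - a" "k \<le> Suc v - u"
  shows "hmax a u b v x k = hmax a u b v y k"
  using assms(3-)
proof (induction "u + v" arbitrary: u v k rule: less_induct)
  case less
  consider "u = 1" | "k = 0" | u' v' where "u = Suc u'" "v = Suc v'" "1 \<le> u'" "u' \<le> v'" "1 \<le> k"
  proof (cases "u = 1 \<or> k = 0")
    case False
    then have "u = Suc (u - 1)" "v = Suc (v - 1)" "1 \<le> u - 1" "u - 1 \<le> v - 1" "1 \<le> k"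
      using less.prems by auto
    then show ?thesis using that(3) by blast
  qed (use that in blast)
  then show ?case
  proof cases
    case 1
    then show ?thesis using init[of v k] less.prems by simp
  next
    case 2
    then show ?thesis using hmax_0 less.prems by simp
  next
    case 3
    have IH: "hmax a u'' b v'' x k'' = hmax a u'' b v'' y k''"
      if "u'' + v'' < u + v" "1 \<le> u''" "u'' \<le> Suc v''" "v'' \<le> s" "k'' \<le> Suc b - a" "k'' \<le> Suc v'' - u''" for u'' v'' k''
      using less.hyps that by blast
    have "hmax a (Suc u') b (Suc v') z k + hmax a u' b v' z k =
      hmax a (Suc u') b v' z (k - 1) + hmax a u' b (Suc v') z k +
      max_part (k < Suc v' - u') (part a (Suc u') b v' z k) (k < Suc b - a) (part a u' b (Suc v') z (Suc k))" for z
      by (rule hmax_interval) (use 3 less.prems ab in auto)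
    from this[of x] this[of y] 3 less.prems show ?thesis
      by (auto simp: max_part_def part_def IH Suc_diff_le split: if_splits)
  qed
qed

subsection \<open>Toggles\<close>

lemma covered_by_rect:
  "covered_by (rect r s) q p \<longleftrightarrow> p \<in> rect r s \<and> q \<in> rect r s \<and> lattice_step q p"
proof -
  obtain i j a b where pq: "p = (i, j)" "q = (a, b)" by (metis surj_pair)
  have lt: "(c, d) < (c', d') \<longleftrightarrow> c \<le> c' \<and> d \<le> d' \<and> (c < c' \<or> d < d')" for c d c' d' :: nat
    by (auto simp: less_prod_def)
  show ?thesis
  proof (intro iffI conjI)
    assume *: "covered_by (rect r s) q p"
    then show "p \<in> rect r s" "q \<in> rect r s" by (auto simp: covered_by_def)
    have "\<not> (q < z \<and> z < p)" if "z \<in> rect r s" for z using * that by (auto simp: covered_by_def)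
    from this[of "(Suc a, b)"] this[of "(a, Suc b)"] show "lattice_step q p"
      using * unfolding pq by (auto simp: covered_by_def rect_def lattice_step_def lt)
  next
    assume *: "p \<in> rect r s \<and> q \<in> rect r s \<and> lattice_step q p"
    have False if "q < z" "z < p" for z
      using * that unfolding pq by (cases z) (auto simp: lt lattice_step_def)
    then show "covered_by (rect r s) q p"
      using * by (auto simp: covered_by_def pq lt lattice_step_def)
  qed
qed

lemma max_below_rect:
  assumes "(i, j) \<in> rect r s"
  shows "max_below r s x (i, j) = max_part (1 < i) (x (i - 1, j)) (1 < j) (x (i, j - 1))"
proof -
  have "{q. covered_by (rect r s) q (i, j)} =
      (if 1 < i then {(i - 1, j)} else {}) \<union> (if 1 < j then {(i, j - 1)} else {})"
    unfolding covered_by_rect using assms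
    by (auto simp: rect_def lattice_step_def One_nat_def split: if_splits)
  then show ?thesis by (simp add: max_below_def max_part_def max.commute)
qed

lemma min_above_rect:
  assumes "(i, j) \<in> rect r s"
  shows "min_above r s x (i, j) =
    (if i < r \<and> j < s then min (x (Suc i, j)) (x (i, Suc j))
     else if i < r then x (Suc i, j) else if j < s then x (i, Suc j) else 1)"
proof -
  have "{q. covered_by (rect r s) (i, j) q} =
      (if i < r then {(Suc i, j)} else {}) \<union> (if j < s then {(i, Suc j)} else {})"
    unfolding covered_by_rect using assms
    by (auto simp: rect_def lattice_step_def One_nat_def split: if_splits)
  then show ?thesis by (simp add: min_above_def min.commute)
qed

lemma max_below_cong:
  "(\<And>q. covered_by (rect r s) q p \<Longrightarrow> x q = y q) \<Longrightarrow> max_below r s x p = max_below r s y p"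
proof -
  assume "\<And>q. covered_by (rect r s) q p \<Longrightarrow> x q = y q"
  then have "x ` {q. covered_by (rect r s) q p} = y ` {q. covered_by (rect r s) q p}" by force
  then show ?thesis by (simp add: max_below_def)
qed

lemma min_above_cong:
  "(\<And>q. covered_by (rect r s) p q \<Longrightarrow> x q = y q) \<Longrightarrow> min_above r s x p = min_above r s y p"
proof -
  assume "\<And>q. covered_by (rect r s) p q \<Longrightarrow> x q = y q"
  then have "x ` {q. covered_by (rect r s) p q} = y ` {q. covered_by (rect r s) p q}" by force
  then show ?thesis by (simp add: min_above_def)
qed

lemma toggle_toggle: "toggle r s p (toggle r s p x) = x"
proof -
  have "max_below r s (x(p := w)) p = max_below r s x p" "min_above r s (x(p := w)) p = min_above r s x p" for w
    by (auto intro!: max_below_cong min_above_cong simp: covered_by_def)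
  then show ?thesis by (simp add: toggle_def)
qed

section \<open>Products of toggles and linear extensions\<close>

lemma compose_Nil: "compose [] x = x"
  by (simp add: compose_def)

lemma compose_Cons: "compose (f # fs) x = f (compose fs x)"
  by (simp add: compose_def)

lemma bij_compose: "(\<And>f. f \<in> set fs \<Longrightarrow> bij f) \<Longrightarrow> bij (compose fs)"
  by (induction fs) (auto simp: compose_def intro: bij_comp)

lemma bij_rho: "bij (rho r s I)"
proof -
  have "bij (toggle r s p)" for p
    by (rule o_bij[of "toggle r s p"]) (auto simp: toggle_toggle)
  then have "bij f" if "f \<in> (\<lambda>i. toggle r s (p i)) ` A" for f p and A :: "nat set" using that by blast
  then show ?thesis unfolding rho_def Let_def by (intro bij_compose) (simp only: set_map)
qed

text \<open>Number a maximal element last. This ensures that the choice made in \<open>rho\<close>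
  denotes a linear extension.\<close>

lemma ex_linear_extension:
  fixes I :: "'a :: order set"
  assumes "finite I"
  shows "\<exists>L. linear_extension I L"
  using assms
proof (induction "card I" arbitrary: I)
  case 0
  then have "I = {}" by simp
  then show ?case by (simp add: linear_extension_def bij_betw_def)
next
  case (Suc n)
  then obtain m where m: "m \<in> I" "\<And>q. q \<in> I \<Longrightarrow> m \<le> q \<Longrightarrow> m = q"
    using finite_has_maximal[of I] by force
  have c: "card (I - {m}) = n" using Suc.hyps(2) m(1) Suc.prems by simp
  then obtain L where L: "linear_extension (I - {m}) L"
    using Suc.hyps(1)[of "I - {m}"] Suc.prems by auto
  then have bij: "bij_betw L (I - {m}) {1..n}" by (simp add: linear_extension_def c)
  let ?L = "L(m := Suc n)"
  have "bij_betw ?L (I - {m}) {1..n}"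
    using bij by (subst bij_betw_cong[of _ _ L]) auto
  then have "bij_betw ?L (insert m (I - {m})) (insert (?L m) {1..n})"
    by (subst notIn_Un_bij_betw3[of m, symmetric, simplified]) auto
  moreover have "insert m (I - {m}) = I" "insert (?L m) {1..n} = {1..card I}"
    using m(1) Suc.hyps(2) by auto
  ultimately have "bij_betw ?L I {1..card I}" by simp
  moreover have "?L p \<le> ?L q" if "p \<in> I" "q \<in> I" "p \<le> q" for p q
  proof -
    have "p \<noteq> m \<Longrightarrow> L p \<le> n" using bij that(1) by (auto simp: bij_betw_def)
    moreover have "p \<noteq> m \<Longrightarrow> q \<noteq> m \<Longrightarrow> L p \<le> L q" using L that by (auto simp: linear_extension_def)
    moreover have "p = m \<Longrightarrow> q = m" using m(2)[of q] that by auto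
    ultimately show ?thesis by auto
  qed
  ultimately have "linear_extension I ?L" unfolding linear_extension_def by blast
  then show ?case by blast
qed

text \<open>\<open>rho\<close> toggles from the top, so each toggle sees the new labels above and the old labels
  below.\<close>

lemma rho_eqI:
  assumes "finite I"
    and in_I: "\<And>p. p \<in> I \<Longrightarrow> y p + z p = min_above r s y p + max_below r s z p"
    and out: "\<And>p. p \<notin> I \<Longrightarrow> y p = z p"
  shows "rho r s I z = y"
proof -
  define L where "L = (SOME L. linear_extension I L)"
  have "linear_extension I L"
    unfolding L_def using ex_linear_extension[OF assms(1)] by (rule someI_ex)
  then have bij: "bij_betw L I {1..card I}" and ord: "\<And>p q. p \<in> I \<Longrightarrow> q \<in> I \<Longrightarrow> p \<le> q \<Longrightarrow> L p \<le> L q"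
    by (auto simp: linear_extension_def)
  let ?t = "\<lambda>i. toggle r s (inv_into I L i)"
  \<comment> \<open>For whichever linear extension was chosen, after the toggles numbered above
    \<open>m\<close> exactly those positions carry their final labels.\<close>
  have main: "compose (map ?t [Suc m..<Suc (card I)]) z = (\<lambda>p. if p \<in> I \<and> m < L p then y p else z p)"
    if "m \<le> card I" for m
    using that
  proof (induction rule: inc_induct)
    case base
    have "\<not> card I < L p" if "p \<in> I" for p
      using bij_betwE[OF bij] that by (metis atLeastAtMost_iff not_less)
    then show ?case by (simp only: upt_rec[of "Suc (card I)"] less_irrefl if_False list.map compose_Nil) (auto simp: fun_eq_iff)
  next
    case (step m)
    define p where "p = inv_into I L (Suc m)"
    have "Suc m \<in> L ` I" using bij step.hyps by (simp add: bij_betw_def)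
    then have p: "p \<in> I" "L p = Suc m"
      unfolding p_def by (auto simp: inv_into_into f_inv_into_f)
    have inj: "q = p" if "q \<in> I" "L q = Suc m" for q
      using bij that p by (auto simp: bij_betw_def inj_on_def)
    let ?w = "\<lambda>q. if q \<in> I \<and> Suc m < L q then y q else z q"
    have "min_above r s ?w p = min_above r s y p"
    proof (rule min_above_cong)
      fix q assume q: "covered_by (rect r s) p q"
      then have "p \<le> q" "p \<noteq> q" by (auto simp: covered_by_def)
      then have "q \<in> I \<Longrightarrow> Suc m < L q" using ord[of p q] p inj[of q] by fastforce
      then show "?w q = y q" using out by auto
    qed
    moreover have "max_below r s ?w p = max_below r s z p"
    proof (rule max_below_cong)
      fix q assume q: "covered_by (rect r s) q p"
      then have "q \<in> I \<Longrightarrow> L q \<le> Suc m" using ord[of q p] p by (auto simp: covered_by_def)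
      then show "?w q = z q" by auto
    qed
    ultimately have "toggle r s p ?w = ?w(p := y p)"
      using in_I[OF p(1)] p by (simp add: toggle_def fun_eq_iff)
    also have "\<dots> = (\<lambda>q. if q \<in> I \<and> m < L q then y q else z q)"
    proof
      fix q
      show "(?w(p := y p)) q = (if q \<in> I \<and> m < L q then y q else z q)"
      proof (cases "q \<in> I \<and> q \<noteq> p")
        case True
        then have "L q \<noteq> Suc m" using inj by blast
        then have "m < L q \<longleftrightarrow> Suc m < L q" by linarith
        with True show ?thesis by simp
      next
        case False
        with p show ?thesis by (cases "q = p") simp_all
      qed
    qed
    finally have "toggle r s p ?w = (\<lambda>q. if q \<in> I \<and> m < L q then y q else z q)" .
    moreover have "[Suc m..<Suc (card I)] = Suc m # [Suc (Suc m)..<Suc (card I)]"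
      using step.hyps by (intro upt_conv_Cons) simp
    ultimately show ?case
      by (simp only: list.map compose_Cons step.IH p_def[symmetric])
  qed
  have "rho r s I z = compose (map ?t [Suc 0..<Suc (card I)]) z"
    by (simp add: rho_def L_def Let_def One_nat_def)
  also have "\<dots> = (\<lambda>p. if p \<in> I \<and> 0 < L p then y p else z p)"
    by (rule main) simp
  also have "\<dots> = y"
  proof
    fix p
    have "p \<in> I \<Longrightarrow> 0 < L p" using bij_betwE[OF bij] by force
    then show "(if p \<in> I \<and> 0 < L p then y p else z p) = y p" using out[of p] by (cases "p \<in> I") simp_all
  qed
  finally show ?thesis .
qed

lemma inv_rho_eqI:
  assumes "finite I"
    and "\<And>p. p \<in> I \<Longrightarrow> y p + z p = min_above r s y p + max_below r s z p"
    and "\<And>p. p \<notin> I \<Longrightarrow> y p = z p"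
  shows "inv (rho r s I) y = z"
proof -
  have "rho r s I z = y" by (rule rho_eqI) (fact assms)+
  then show ?thesis using inv_f_f[OF bij_is_inj[OF bij_rho], of r s I z] by simp
qed

subsection \<open>RSK\<close>

lemma inj_transfer: "inj (transfer r s)"
proof (rule injI)
  fix z z' assume eq: "transfer r s z = transfer r s z'"
  have "z p = z' p" for p
  proof (induction "fst p + snd p" arbitrary: p rule: less_induct)
    case less
    have "max_below r s z p = max_below r s z' p"
      by (intro max_below_cong less.hyps) (auto simp: covered_by_rect lattice_step_def)
    then show ?case using fun_cong[OF eq, of p] by (auto simp: transfer_def split: if_splits)
  qed
  then show "z = z'" by (rule ext)
qed

text \<open>The labelling after \<open>l\<close> inverse products: the entry at
  \<open>(i, j)\<close> has followed its diagonal for \<open>m\<close> steps, stopping at the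
  border, and is part number \<open>m + 1\<close> of the initial rectangle reached. At the last
  stage every diagonal has arrived at the border.\<close>

definition RSK_stage :: "nat \<Rightarrow> nat \<Rightarrow> labelling \<Rightarrow> nat \<Rightarrow> labelling" where
  "RSK_stage r s x l = (\<lambda>(i, j). if (i, j) \<in> rect r s then
     (let m = min l (min (r - i) (s - j)) in part 1 1 (i + m) (j + m) x (Suc m)) else x (i, j))"

lemma transfer_RSK_stage: "transfer r s (RSK_stage r s x 0) = x"
proof
  fix p :: "nat \<times> nat"
  show "transfer r s (RSK_stage r s x 0) p = x p"
  proof (cases "p \<in> rect r s")
    case True
    then obtain b d where p: "p = (Suc b, Suc d)" "(Suc b, Suc d) \<in> rect r s"
      by (cases p; cases "fst p"; cases "snd p") (auto simp: rect_def)
    then have "0 < b \<Longrightarrow> (b, Suc d) \<in> rect r s" "0 < d \<Longrightarrow> (Suc b, d) \<in> rect r s" by (auto simp: rect_def)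
    then show ?thesis using p part_corner_1[of b d x]
      by (auto simp: transfer_def max_below_rect RSK_stage_def max_part_def One_nat_def)
  qed (cases p; simp add: transfer_def RSK_stage_def)
qed

lemma bij_transfer: "bij (transfer r s)"
  by (rule bijI[OF inj_transfer]) (rule surjI[where f = "\<lambda>x. RSK_stage r s x 0"], rule transfer_RSK_stage)

lemma inv_transfer: "inv (transfer r s) x = RSK_stage r s x 0"
  using inv_f_f[OF inj_transfer, of r s "RSK_stage r s x 0"] by (simp add: transfer_RSK_stage)

text \<open>In an inverse product the old labels stand above and the new ones below, as in
  \<open>part_corner_Suc\<close>. Inside the smaller rectangle both upper neighbours exist, so the
  default 1 of an empty minimum never enters.\<close>

lemma RSK_stage_Suc:
  assumes "Suc m < min r s"
  shows "inv (rho r s (rect (r - Suc m) (s - Suc m))) (RSK_stage r s x m) = RSK_stage r s x (Suc m)"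
proof (rule inv_rho_eqI)
  show "finite (rect (r - Suc m) (s - Suc m))" by (simp add: rect_def)
next
  fix p assume "p \<in> rect (r - Suc m) (s - Suc m)"
  then obtain i j where p: "p = (i, j)" "1 \<le> i" "1 \<le> j" "i + Suc m \<le> r" "j + Suc m \<le> s"
    using assms by (auto simp: rect_def)
  have new: "RSK_stage r s x (Suc m) (a, b) = part 1 1 (a + Suc m) (b + Suc m) x (Suc (Suc m))"
    if "1 \<le> a" "1 \<le> b" "a \<le> i" "b \<le> j" for a b
  proof -
    have "min (Suc m) (min (r - a) (s - b)) = Suc m" using p that by auto
    then show ?thesis using p that by (simp add: RSK_stage_def rect_def)
  qed
  have old: "RSK_stage r s x m (a, b) = part 1 1 (a + m) (b + m) x (Suc m)"
    if "1 \<le> a" "1 \<le> b" "a \<le> Suc i" "b \<le> Suc j" for a b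
  proof -
    have "min m (min (r - a) (s - b)) = m" using p that by auto
    then show ?thesis using p that by (simp add: RSK_stage_def rect_def)
  qed
  have "p \<in> rect r s" using p by (simp add: rect_def)
  then show "RSK_stage r s x m p + RSK_stage r s x (Suc m) p =
      min_above r s (RSK_stage r s x m) p + max_below r s (RSK_stage r s x (Suc m)) p"
    using p part_corner_Suc[of "Suc m" "i + m" "j + m" x]
    by (auto simp: max_below_rect min_above_rect old new max_part_def One_nat_def)
next
  fix p assume "p \<notin> rect (r - Suc m) (s - Suc m)"
  moreover obtain i j where "p = (i, j)" by (metis surj_pair)
  ultimately have "p \<in> rect r s \<Longrightarrow> min m (min (r - i) (s - j)) = min (Suc m) (min (r - i) (s - j))"
    by (auto simp: rect_def)
  then show "RSK_stage r s x m p = RSK_stage r s x (Suc m) p"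
    using \<open>p = (i, j)\<close> by (auto simp: RSK_stage_def)
qed

lemma RSK_eq_stage:
  assumes "1 \<le> r" "1 \<le> s"
  shows "RSK r s x = RSK_stage r s x (min r s - 1)"
proof -
  have "compose (map (\<lambda>l. inv (rho r s (rect (r - l) (s - l)))) (rev [1..<Suc n])) (RSK_stage r s x 0) =
      RSK_stage r s x n" if "n < min r s" for n
    using that
  proof (induction n)
    case (Suc n)
    have "rev [1..<Suc (Suc n)] = Suc n # rev [1..<Suc n]" by simp
    then show ?case using Suc RSK_stage_Suc[OF Suc.prems, of x] by (simp only: list.map compose_Cons)
  qed (simp add: compose_Nil One_nat_def)
  from this[of "min r s - 1"] have "compose (map (\<lambda>l. inv (rho r s (rect (r - l) (s - l))))
      (rev [1..<Suc (min r s - 1)])) (RSK_stage r s x 0) = RSK_stage r s x (min r s - 1)"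
    using assms by linarith
  moreover have "Suc (min r s - 1) = min r s" using assms by auto
  ultimately show ?thesis by (simp only: RSK_def comp_apply inv_transfer)
qed

text \<open>The analogue of Greene's theorem.\<close>

lemma RSK_apply:
  assumes "1 \<le> t" "t \<le> i" "t \<le> j" "i \<le> r" "j \<le> s" "i = r \<or> j = s"
  shows "RSK r s x (i + 1 - t, j + 1 - t) = part 1 1 i j x t"
proof -
  have m: "min (min r s - 1) (min (r - (i + 1 - t)) (s - (j + 1 - t))) = t - 1" using assms by auto
  have "(i + 1 - t, j + 1 - t) \<in> rect r s" using assms by (auto simp: rect_def)
  moreover have "i + 1 - t + (t - 1) = i" "j + 1 - t + (t - 1) = j" "Suc (t - 1) = t" using assms by auto
  moreover have "1 \<le> r" "1 \<le> s" using assms by auto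
  ultimately show ?thesis
    by (simp only: RSK_eq_stage RSK_stage_def prod.case Let_def m if_True)
qed

lemma bij_RSK: "bij (RSK r s)"
  unfolding RSK_def
proof (rule bij_comp[OF bij_imp_bij_inv[OF bij_transfer] bij_compose])
  fix f assume "f \<in> set (map (\<lambda>l. inv (rho r s (rect (r - l) (s - l)))) (rev [1..<min r s]))"
  then obtain l where "f = inv (rho r s (rect (r - l) (s - l)))" by auto
  then show "bij f" by (simp only: bij_imp_bij_inv[OF bij_rho])
qed

subsection \<open>Evacuation\<close>

text \<open>The labelling whose file through \<open>(r, c)\<close> lists the parts of the shape of the columns
  \<open>e c + 1, \<dots>, e c + c\<close>, for \<open>c \<le> s\<close>. Toggling that file increments \<open>e c\<close>.\<close>

definition interval_state :: "nat \<Rightarrow> nat \<Rightarrow> labelling \<Rightarrow> labelling \<Rightarrow> (nat \<Rightarrow> nat) \<Rightarrow> labelling" where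
  "interval_state r s x y e = (\<lambda>(i, j). if (i, j) \<in> rect r s \<and> j + (r - i) \<le> s
     then let c = j + (r - i) in part 1 (Suc (e c)) r (e c + c) x (Suc (r - i)) else y (i, j))"

lemma interval_state_at:
  assumes "(i, j) \<in> rect r s" "j + (r - i) = c" "c \<le> s"
  shows "interval_state r s x y e (i, j) = part 1 (Suc (e c)) r (e c + c) x (Suc (r - i))"
  using assms by (auto simp: interval_state_def Let_def)

text \<open>A file is named by the column \<open>c = j + (r - i)\<close> in which it meets row
  \<open>r\<close>; as \<open>c < j'\<close>, it lies entirely within
  \<open>rect r j'\<close>.\<close>

lemma file_mem:
  assumes "c < j'" "j' \<le> s"
  shows "(i, j) \<in> poset_file r s (int r - int c) \<inter> rect r j' \<longleftrightarrow> (i, j) \<in> rect r s \<and> j + (r - i) = c"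
  using assms by (auto simp: poset_file_def rect_def)

text \<open>The conditions on \<open>e\<close> describe a sweep by increasing \<open>c\<close>: file
  \<open>c - 1\<close> has already advanced and file \<open>c + 1\<close> has not. The neighbours
  thus carry the intervals \<open>u + 1..v\<close> and \<open>u..v + 1\<close>, and
  \<open>part_interval\<close> is the toggle. Since \<open>j < s\<close>, a right neighbour exists
  and the default 1 does not occur.\<close>

lemma rho_file:
  assumes c: "1 \<le> c" "c < j'" "j' \<le> s"
    and e: "1 < c \<Longrightarrow> e (c - 1) = Suc (e c)" "e (Suc c) = e c"
  shows "rho r s (poset_file r s (int r - int c) \<inter> rect r j') (interval_state r s x y e) =
    interval_state r s x y (e(c := Suc (e c)))"
proof (rule rho_eqI)
  show "finite (poset_file r s (int r - int c) \<inter> rect r j')" by (simp add: rect_def)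
next
  fix p assume p': "p \<in> poset_file r s (int r - int c) \<inter> rect r j'"
  obtain i j where p: "p = (i, j)" by (metis surj_pair)
  then have R: "(i, j) \<in> rect r s" and ij: "j + (r - i) = c" using p' file_mem[OF c(2,3)] by auto
  then have ij': "1 \<le> i" "i \<le> r" "1 \<le> j" "j \<le> c" "j < s" using c by (auto simp: rect_def)
  let ?u = "Suc (e c)" and ?v = "e c + c" and ?t = "Suc (r - i)"
  let ?z = "interval_state r s x y e" and ?y = "interval_state r s x y (e(c := Suc (e c)))"
  have c': "c - 1 \<noteq> c" "Suc (e c) + (c - 1) = e c + c" using c by auto
  have at: "?z p = part 1 ?u r ?v x ?t" "?y p = part 1 (Suc ?u) r (Suc ?v) x ?t"
    using interval_state_at[OF R ij] c by (simp_all add: p)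
  have up: "?y (Suc i, j) = part 1 (Suc ?u) r ?v x (?t - 1)" if "i < r"
  proof -
    have "j + (r - Suc i) = c - 1" "1 < c" "(Suc i, j) \<in> rect r s" "Suc (r - Suc i) = ?t - 1"
      using that R ij ij' c by (auto simp: rect_def)
    moreover from this have "(e(c := Suc (e c))) (c - 1) = Suc (e c)" "c - 1 \<le> s" using e(1) c by auto
    ultimately show ?thesis
      by (simp only: interval_state_at[of "Suc i" j r s "c - 1"] c'(2))
  qed
  have right: "?y (i, Suc j) = part 1 ?u r (Suc ?v) x ?t"
  proof -
    have "(i, Suc j) \<in> rect r s" "Suc j + (r - i) = Suc c" using R ij ij' c by (auto simp: rect_def)
    then show ?thesis using e(2) c interval_state_at[of i "Suc j" r s "Suc c"] by simp
  qed
  have down: "?z (i - 1, j) = part 1 ?u r (Suc ?v) x (Suc ?t)" if "1 < i"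
  proof -
    have "(i - 1, j) \<in> rect r s" "j + (r - (i - 1)) = Suc c" "r - (i - 1) = Suc (r - i)"
      using that R ij ij' c by (auto simp: rect_def)
    then show ?thesis using e(2) c interval_state_at[of "i - 1" j r s "Suc c"] by simp
  qed
  have left: "?z (i, j - 1) = part 1 (Suc ?u) r ?v x ?t" if "1 < j"
  proof -
    have "(i, j - 1) \<in> rect r s" "j - 1 + (r - i) = c - 1" "1 < c" using that R ij ij' c by (auto simp: rect_def)
    then show ?thesis using e(1) c c' interval_state_at[of i "j - 1" r s "c - 1"] by simp
  qed
  have "min_above r s ?y p = (if ?t = 1 then part 1 ?u r (Suc ?v) x ?t
      else min (part 1 (Suc ?u) r ?v x (?t - 1)) (part 1 ?u r (Suc ?v) x ?t))"
    using p R ij' up right by (auto simp: min_above_rect One_nat_def)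
  moreover have "max_below r s ?z p = max_part (?t < Suc ?v - ?u) (part 1 (Suc ?u) r ?v x ?t)
      (?t < Suc r - 1) (part 1 ?u r (Suc ?v) x (Suc ?t))"
  proof -
    have "1 < j \<longleftrightarrow> ?t < Suc ?v - ?u" "1 < i \<longleftrightarrow> ?t < Suc r - 1" using ij ij' by auto
    then show ?thesis
      using p R down left by (auto simp: max_below_rect max_part_def max.commute)
  qed
  moreover have "?t \<le> Suc r - 1" "?t \<le> Suc ?v - ?u" using ij ij' by auto
  ultimately show "?y p + ?z p = min_above r s ?y p + max_below r s ?z p"
    unfolding at using part_interval[of ?t r 1 ?v ?u x] ij' c by (auto simp: One_nat_def)
next
  fix p assume "p \<notin> poset_file r s (int r - int c) \<inter> rect r j'"
  moreover obtain i j where p: "p = (i, j)" by (metis surj_pair)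
  ultimately have "(i, j) \<in> rect r s \<Longrightarrow> j + (r - i) \<noteq> c"
    using file_mem[OF c(2,3), of i j r] by auto
  then show "interval_state r s x y (e(c := Suc (e c))) p = interval_state r s x y e p"
    by (auto simp: p interval_state_def Let_def)
qed

lemma upto_file_list:
  "[int r - int (Suc n) + 1..int r - 1] = map (\<lambda>c. int r - int c) (rev [1..<Suc n])"
proof (induction n)
  case (Suc n)
  have "[int r - int (Suc (Suc n)) + 1..int r - 1] = (int r - int (Suc n)) # [int r - int (Suc n) + 1..int r - 1]"
    by (subst upto_rec1) auto
  moreover have "rev [1..<Suc (Suc n)] = Suc n # rev [1..<Suc n]" by simp
  ultimately show ?case by (simp only: Suc.IH list.map)
qed (simp add: One_nat_def)

lemma Pro_interval_state:
  assumes l: "Suc l < s"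
  shows "Pro r s r (s - l) (interval_state r s x y (\<lambda>c. min l (s - c))) =
    interval_state r s x y (\<lambda>c. min (Suc l) (s - c))"
proof -
  let ?f = "\<lambda>k. rho r s (poset_file r s k \<inter> rect r (s - l))"
  \<comment> \<open>The offsets after the first \<open>n\<close> files have been toggled. Files with
    \<open>c >= s - l\<close> already show intervals ending at \<open>s\<close> and stay
    put.\<close>
  let ?e = "\<lambda>n c. if 1 \<le> c \<and> c \<le> n then Suc l else min l (s - c)"
  have "compose (map (\<lambda>c. ?f (int r - int c)) (rev [1..<Suc n])) (interval_state r s x y (?e 0)) =
      interval_state r s x y (?e n)" if "n < s - l" for n
    using that
  proof (induction n)
    case (Suc n)
    have "rev [1..<Suc (Suc n)] = Suc n # rev [1..<Suc n]" by simp
    then have "compose (map (\<lambda>c. ?f (int r - int c)) (rev [1..<Suc (Suc n)])) (interval_state r s x y (?e 0)) =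
        ?f (int r - int (Suc n)) (interval_state r s x y (?e n))"
      using Suc by (simp only: list.map compose_Cons)
    also have "\<dots> = interval_state r s x y ((?e n)(Suc n := Suc (?e n (Suc n))))"
      by (rule rho_file) (use Suc.prems in auto)
    also have "(?e n)(Suc n := Suc (?e n (Suc n))) = ?e (Suc n)"
      using Suc.prems by (auto simp: fun_eq_iff)
    finally show ?case .
  qed (simp add: compose_Nil One_nat_def)
  from this[of "s - l - 1"] have "Pro r s r (s - l) (interval_state r s x y (?e 0)) =
      interval_state r s x y (?e (s - l - 1))"
    using upto_file_list[of r "s - l - 1"] l by (simp add: Pro_def comp_def One_nat_def)
  moreover have "?e 0 = (\<lambda>c. min l (s - c))" by auto
  moreover have "interval_state r s x y (?e (s - l - 1)) = interval_state r s x y (\<lambda>c. min (Suc l) (s - c))"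
  proof -
    \<comment> \<open>The offset at \<open>c = 0\<close> may differ, but every position of the
      rectangle has \<open>c >= 1\<close>.\<close>
    have "?e (s - l - 1) c = min (Suc l) (s - c)" if "1 \<le> c" for c using that l by auto
    then show ?thesis by (auto simp: interval_state_def rect_def fun_eq_iff Let_def)
  qed
  ultimately show ?thesis by simp
qed

lemma Evac_interval_state:
  assumes "1 \<le> s"
  shows "Evac r s (interval_state r s x y (\<lambda>c. 0)) = interval_state r s x y (\<lambda>c. s - c)"
proof -
  have "compose (map (Pro r s r) [s + 1 - l..<s + 1]) (interval_state r s x y (\<lambda>c. 0)) =
      interval_state r s x y (\<lambda>c. min l (s - c))" if "l < s" for l
    using that
  proof (induction l)
    case (Suc l)
    have "s + 1 - Suc l = s - l" "s + 1 - l = Suc (s - l)" "s - l < s + 1" using Suc.prems by auto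
    then have "[s + 1 - Suc l..<s + 1] = (s - l) # [s + 1 - l..<s + 1]"
      by (simp only: upt_conv_Cons)
    then show ?case
      using Suc Pro_interval_state[of l s r x y] by (simp only: list.map compose_Cons)
  qed (simp add: compose_Nil)
  from this[of "s - 1"] have "Evac r s (interval_state r s x y (\<lambda>c. 0)) = interval_state r s x y (\<lambda>c. min (s - 1) (s - c))"
    using assms by (simp add: Evac_def numeral_2_eq_2 One_nat_def)
  also have "\<dots> = interval_state r s x y (\<lambda>c. s - c)"
  proof -
    have "min (s - 1) (s - c) = s - c" if "1 \<le> c" for c using that by auto
    then show ?thesis by (auto simp: interval_state_def rect_def fun_eq_iff Let_def)
  qed
  finally show ?thesis .
qed

lemma RSK_interval_state:
  "RSK r s x = interval_state r s x (RSK r s x) (\<lambda>c. 0)"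
proof
  fix p :: "nat \<times> nat"
  obtain i j where p: "p = (i, j)" by (metis surj_pair)
  show "RSK r s x p = interval_state r s x (RSK r s x) (\<lambda>c. 0) p"
  proof (cases "(i, j) \<in> rect r s \<and> j + (r - i) \<le> s")
    case True
    then have "Suc (r - i) \<le> r" "Suc (r - i) \<le> j + (r - i)"
      "r + 1 - Suc (r - i) = i" "j + (r - i) + 1 - Suc (r - i) = j" by (auto simp: rect_def)
    then show ?thesis
      using RSK_apply[of "Suc (r - i)" r "j + (r - i)" r s x] True interval_state_at[of i j r s] by (simp add: p One_nat_def)
  qed (auto simp: p interval_state_def)
qed

lemma Evac_RSK_apply:
  assumes "1 \<le> s" "1 \<le> t" "t \<le> r" "t \<le> c" "c \<le> s"
  shows "Evac r s (RSK r s x) (r + 1 - t, c + 1 - t) = part 1 (Suc (s - c)) r s x t"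
proof -
  have "(r + 1 - t, c + 1 - t) \<in> rect r s" "c + 1 - t + (r - (r + 1 - t)) = c" "Suc (r - (r + 1 - t)) = t"
    using assms by (auto simp: rect_def)
  then show ?thesis
    using assms by (subst RSK_interval_state, subst Evac_interval_state) (auto simp: interval_state_def)
qed

text \<open>For \<open>i < r\<close> these positions lie on files beyond \<open>c = s\<close>, which
  no promotion toggles; for \<open>i = r\<close> the full range of columns is both its own initial
  and its own final interval.\<close>

lemma Evac_RSK_apply_last:
  assumes "1 \<le> s" "1 \<le> t" "t \<le> i" "t \<le> s" "i \<le> r"
  shows "Evac r s (RSK r s x) (i + 1 - t, s + 1 - t) = part 1 1 i s x t"
proof (cases "i = r")
  case True
  then show ?thesis using Evac_RSK_apply[of s t r s x] assms by (simp add: One_nat_def)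
next
  case False
  then have "\<not> s + 1 - t + (r - (i + 1 - t)) \<le> s" using assms by auto
  then have "Evac r s (RSK r s x) (i + 1 - t, s + 1 - t) = RSK r s x (i + 1 - t, s + 1 - t)"
    by (subst RSK_interval_state, subst Evac_interval_state[OF assms(1)]) (simp add: interval_state_def)
  then show ?thesis using RSK_apply[of t i s r s x] assms by simp
qed

section \<open>Comparison of the path statistics\<close>

lemma hmax_eq_if_parts:
  assumes "\<And>t. 1 \<le> t \<Longrightarrow> t \<le> k \<Longrightarrow> part a u b v x t = part a' u' b' v' y t" "u \<le> Suc v" "u' \<le> Suc v'"
  shows "hmax a u b v x k = hmax a' u' b' v' y k"
  using assms(1)
proof (induction k)
  case (Suc k)
  then show ?case using Suc.prems[of "Suc k"] by (simp add: part_def One_nat_def)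
qed (use assms hmax_0 in simp)

theorem lemma5p4:
  fixes r s k :: nat and x :: "nat \<times> nat \<Rightarrow> real"
  assumes "1 \<le> r" and "1 \<le> s"
  shows "(\<forall>u v. 1 \<le> u \<and> u \<le> v \<and> v \<le> r \<longrightarrow>
            H u 1 v s x k = H u 1 v s ((inv (RSK r s) \<circ> Evac r s \<circ> RSK r s) x) k) \<and>
         (\<forall>u v. 1 \<le> u \<and> u \<le> v \<and> v \<le> s \<longrightarrow>
            H 1 u r v x k =
            H 1 (s + 1 - v) r (s + 1 - u) ((inv (RSK r s) \<circ> Evac r s \<circ> RSK r s) x) k)"
proof -
  define x' where "x' = (inv (RSK r s) \<circ> Evac r s \<circ> RSK r s) x"
  have RSK': "RSK r s x' = Evac r s (RSK r s x)"
    by (simp add: x'_def surj_f_inv_f[OF bij_is_surj[OF bij_RSK]])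
  let ?rot = "\<lambda>(i, c). x (1 + r - i, Suc s - c)"
  have rot: "hmax 1 u r v x k = hmax 1 (Suc s - v) r (Suc s - u) ?rot k"
    if "u \<le> v" "v \<le> s" "k \<le> r" "u + k \<le> Suc v" for u v k
    using hmax_rotate[of k r 1 u v "Suc s" x] that by (simp add: One_nat_def)
  \<comment> \<open>The final intervals of \<open>x\<close> are turned into initial intervals of the
    rotated labelling, because \<open>hmax_determined\<close> takes agreement on initial intervals
    as its input.\<close>
  have columns: "hmax 1 1 r c x' k = hmax 1 1 r c ?rot k" if "c \<le> s" "k \<le> Suc r - 1" "k \<le> c" for c k
  proof (cases "c = 0")
    case False
    have "hmax 1 1 r c x' k = hmax 1 (Suc (s - c)) r s x k"
    proof (rule hmax_eq_if_parts)
      fix t assume t: "1 \<le> t" "t \<le> k"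
      then show "part 1 1 r c x' t = part 1 (Suc (s - c)) r s x t"
        using RSK_apply[of t r c r s x'] Evac_RSK_apply[of s t r c x] RSK' that assms by simp
    qed (use that in auto)
    also have "\<dots> = hmax 1 1 r c ?rot k"
      using rot[of "Suc (s - c)" s k] that False by (simp add: One_nat_def)
    finally show ?thesis .
  qed (use that hmax_0 in simp)
  have rows: "hmax 1 1 i s x k = hmax 1 1 i s x' k" if "i \<le> r" "k \<le> i" "k \<le> s" for i k
  proof (rule hmax_eq_if_parts)
    fix t assume t: "1 \<le> t" "t \<le> k"
    then show "part 1 1 i s x t = part 1 1 i s x' t"
      using RSK_apply[of t i s r s x'] Evac_RSK_apply_last[of s t i r x] RSK' that assms by simp
  qed (use assms in auto)
  let ?t = "\<lambda>x (i, c). x (c, i)"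
  have rows': "hmax 1 1 s i (?t x) k = hmax 1 1 s i (?t x') k" if "i \<le> r" "k \<le> Suc s - 1" "k \<le> i" for i k
  proof (cases "i = 0")
    case False
    then show ?thesis
      using rows[of i k] hmax_transpose[of k i 1 1 s x] hmax_transpose[of k i 1 1 s x'] that assms by simp
  qed (use that hmax_0 in simp)
  show ?thesis
  proof (intro conjI allI impI; elim conjE; fold x'_def)
    fix u v assume uv: "1 \<le> u" "u \<le> v" "v \<le> r"
    let ?k = "min k (min (Suc v - u) (Suc s - 1))"
    \<comment> \<open>Transposition turns an interval of rows into an interval of columns, where
      \<open>rows'\<close> supplies the initial values.\<close>
    have "hmax u 1 v s z ?k = hmax 1 u s v (?t z) ?k" for z
      by (rule hmax_transpose) (use uv assms in auto)
    moreover have "hmax 1 u s v (?t x) ?k = hmax 1 u s v (?t x') ?k"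
      by (rule hmax_determined[where s = r and x = "?t x" and y = "?t x'"]) (use rows' uv assms in auto)
    ultimately show "H u 1 v s x k = H u 1 v s x' k"
      using uv assms by (simp add: H_eq_hmax)
  next
    fix u v assume uv: "1 \<le> u" "u \<le> v" "v \<le> s"
    let ?k = "min k (min (Suc r - 1) (Suc v - u))"
    have "hmax 1 u r v x ?k = hmax 1 (Suc s - v) r (Suc s - u) ?rot ?k"
      by (rule rot) (use uv in auto)
    also have "\<dots> = hmax 1 (Suc s - v) r (Suc s - u) x' ?k"
      by (rule hmax_determined[where s = s and x = ?rot and y = x', OF columns[symmetric]]) (use uv assms in auto)
    finally have "hmax 1 u r v x ?k = hmax 1 (Suc s - v) r (Suc s - u) x' ?k" .
    then have eq: "hmax 1 u r v x ?k = hmax 1 (Suc s - v) r (Suc s - u) x' ?k" .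
    show "H 1 u r v x k = H 1 (s + 1 - v) r (s + 1 - u) x' k"
    proof -
      have "Suc (Suc s - u) - (Suc s - v) = Suc v - u" using uv by simp
      moreover have "Suc s - v \<le> Suc s - u" using uv by simp
      ultimately show ?thesis
        using H_eq_hmax[of 1 r u v x k] H_eq_hmax[of 1 r "Suc s - v" "Suc s - u" x' k] eq uv assms
        by (simp only: Suc_eq_plus1[symmetric])
    qed
  qed
qed

end
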